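(* For $d\in\mathbb{N}$ let $F_d^2$ be the subspace of the Wiener algebra over $[0,1)^d$ defined by $$F_d^2:=\left\{ f\in C([0,1)^d)\;\middle|\; \|f\|:=\sum_{\boldsymbol{k}\in \mathbb{Z}^{d}}|\hat{f}(\boldsymbol{k})|\max\left(\mathrm{width}(\mathrm{supp}(\boldsymbol{k})),\min_{j\in \mathrm{supp}(\boldsymbol{k})}\log |k_j|\right)<\infty \right\}.$$ Then there exists a positive constant $C_2$ such that, for any $d\in\mathbb{N}$ and any $\varepsilon\in(0,1)$, $$n(\varepsilon,d,F_d^2)\leq \frac{C_2\,\varepsilon^{-3}}{\log \varepsilon^{-1}}.$$
   Context: Here $\mathbb{N}=\{1,2,\ldots\}$ and $\log$ is the natural logarithm. Functions $f$ are real-valued on $[0,1)^d$; elements of $C([0,1)^d)$ are continuous functions, taken to be integrable so that the Fourier coefficients $$\hat{f}(\boldsymbol{k})=\int_{[0,1)^d}f(\boldsymbol{x})\exp(-2\pi i\,\boldsymbol{k}\cdot\boldsymbol{x})\,\mathrm{d}\boldsymbol{x},\qquad \boldsymbol{k}\in\mathbb{Z}^d,$$ are defined. For $\boldsymbol{k}=(k_1,\ldots,k_d)\in\mathbb{Z}^d$, $\mathrm{supp}(\boldsymbol{k}):=\{j\in\{1,\ldots,d\}\mid k_j\neq 0\}$. For a non-empty subset $u\subseteq\{1,\ldots,d\}$, $\mathrm{width}(u):=\max_{j\in u}j-\min_{j\in u}j+1$, and $\mathrm{width}(\emptyset):=1$. For $\boldsymbol{k}=\boldsymbol{0}$ the minimum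 over the empty set is disregarded, so that the factor $\max(\cdot,\cdot)$ equals $1$. For an integrand $f$, write $I_d(f)=\int_{[0,1)^d}f(\boldsymbol{x})\,\mathrm{d}\boldsymbol{x}$. An algorithm using $n$ function values is $Q_{d,n}(f)=\sum_{h=0}^{n-1}w_hf(\boldsymbol{x}_h)$ with sampling points $\boldsymbol{x}_0,\ldots,\boldsymbol{x}_{n-1}\in[0,1)^d$ and real weights $w_0,\ldots,w_{n-1}$. Its worst-case error in a Banach space $F$ with norm $\|\cdot\|$ is $$e^{\mathrm{wor}}(F,Q_{d,n}):=\sup_{f\in F,\ \|f\|\leq 1}|I_d(f)-Q_{d,n}(f)|,$$ and the information complexity is $$n(\varepsilon,d,F):=\min\{n\in\mathbb{N}\mid \exists\, Q_{d,n}:\ e^{\mathrm{wor}}(F,Q_{d,n})\leq\varepsilon\}.$$ *)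

theory Defs
  imports "HOL-Analysis.Analysis"
begin

text \<open>The dimension \<open>d\<close> is a variable of the statement (the constant must not depend on it), so
  points of \<open>[0,1)\<^sup>d\<close> and frequencies in \<open>\<int>\<^sup>d\<close> are extensional functions on \<open>{1..d}\<close>.\<close>

definition cube :: "nat \<Rightarrow> (nat \<Rightarrow> real) set" where
  "cube d = ({1..d} \<rightarrow>\<^sub>E {0..<1})"

definition cube_measure :: "nat \<Rightarrow> (nat \<Rightarrow> real) measure" where
  "cube_measure d = (\<Pi>\<^sub>M j\<in>{1..d}. restrict_space lborel {0..<1})"

definition freqs :: "nat \<Rightarrow> (nat \<Rightarrow> int) set" where
  "freqs d = ({1..d} \<rightarrow>\<^sub>E UNIV)"

definition fourier_coeff :: "nat \<Rightarrow> ((nat \<Rightarrow> real) \<Rightarrow> real) \<Rightarrow> (nat \<Rightarrow> int) \<Rightarrow> complex" where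
  "fourier_coeff d f k =
     (\<integral>x. complex_of_real (f x) *
          exp (- 2 * complex_of_real pi * \<i> * complex_of_real (\<Sum>j=1..d. of_int (k j) * x j))
      \<partial>cube_measure d)"

definition supp :: "nat \<Rightarrow> (nat \<Rightarrow> int) \<Rightarrow> nat set" where
  "supp d k = {j \<in> {1..d}. k j \<noteq> 0}"

definition width :: "nat set \<Rightarrow> nat" where
  "width u = (if u = {} then 1 else Max u - Min u + 1)"

text \<open>For \<open>k = 0\<close> the minimum over the empty support is dropped, leaving \<open>width {} = 1\<close>.\<close>

definition weight :: "nat \<Rightarrow> (nat \<Rightarrow> int) \<Rightarrow> real" where
  "weight d k =
     (if supp d k = {} then real (width (supp d k))
      else max (real (width (supp d k))) (MIN j\<in>supp d k. ln \<bar>real_of_int (k j)\<bar>))"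

definition F2_norm :: "nat \<Rightarrow> ((nat \<Rightarrow> real) \<Rightarrow> real) \<Rightarrow> real" where
  "F2_norm d f = (\<Sum>\<^sub>\<infinity>k\<in>freqs d. cmod (fourier_coeff d f k) * weight d k)"

text \<open>\<open>continuous_on\<close> refers to the product topology on \<open>nat \<Rightarrow> real\<close>; on the extensional
  set \<open>cube d\<close> this is the usual topology of \<open>[0,1)\<^sup>d\<close>. A continuous function on the half-open cube
  need not be integrable, so integrability is required explicitly. Extensionality makes the
  elements functions on the cube only.\<close>

definition F2 :: "nat \<Rightarrow> ((nat \<Rightarrow> real) \<Rightarrow> real) set" where
  "F2 d = {f \<in> extensional (cube d).
             continuous_on (cube d) f \<and> integrable (cube_measure d) f \<and>
             (\<lambda>k. cmod (fourier_coeff d f k) * weight d k) summable_on freqs d}"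

definition cubature ::
  "nat \<Rightarrow> (nat \<Rightarrow> nat \<Rightarrow> real) \<Rightarrow> (nat \<Rightarrow> real) \<Rightarrow> ((nat \<Rightarrow> real) \<Rightarrow> real) \<Rightarrow> real" where
  "cubature n x w f = (\<Sum>h<n. w h * f (x h))"

text \<open>The supremum is taken in the extended reals, so it is \<open>\<infinity>\<close> when the errors are unbounded.\<close>

definition worst_case_error ::
  "nat \<Rightarrow> ((nat \<Rightarrow> real) \<Rightarrow> real) set \<Rightarrow> (((nat \<Rightarrow> real) \<Rightarrow> real) \<Rightarrow> real) \<Rightarrow>
   (((nat \<Rightarrow> real) \<Rightarrow> real) \<Rightarrow> real) \<Rightarrow> ereal" where
  "worst_case_error d F nrm Q =
     (SUP f\<in>{f \<in> F. nrm f \<le> 1}. ereal \<bar>(\<integral>x. f x \<partial>cube_measure d) - Q f\<bar>)"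

text \<open>An infimum in \<open>enat\<close>: it is attained if some \<open>n\<close> is admissible, and \<open>\<infinity>\<close> otherwise.\<close>

definition info_complexity ::
  "real \<Rightarrow> nat \<Rightarrow> ((nat \<Rightarrow> real) \<Rightarrow> real) set \<Rightarrow> (((nat \<Rightarrow> real) \<Rightarrow> real) \<Rightarrow> real) \<Rightarrow> enat" where
  "info_complexity \<epsilon> d F nrm =
     (INF n\<in>{n. n \<ge> 1 \<and> (\<exists>x w. (\<forall>h<n. x h \<in> cube d) \<and>
                             worst_case_error d F nrm (cubature n x w) \<le> ereal \<epsilon>)}. enat n)"

end

theory Submission
  imports Defs "HOL-Probability.Infinite_Product_Measure" "HOL-Real_Asymp.Real_Asymp"
begin

text \<open>
  A cubature rule whose weights add up to 1 and that integrates every character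
  $e_k(x) = e^{2\pi i k \cdot x}$, $k \neq 0$, with error at most \<open>\<epsilon> * weight d k\<close> has
  worst-case error at most \<open>\<epsilon>\<close>, because every function of the space equals its absolutely convergent Fourier series at every point of the cube
  (\<open>fourier_inversion\<close>, \<open>cubature_error_le\<close>). The task is to find such a rule with few points and with
  no dependence on \<open>d\<close>.

  For one prime \<open>p\<close>, take the \<open>p\<^sup>2\<close> points whose coordinates are the fractional parts of
  $a b^j / p$ for \<open>a, b < p\<close>. Summing over \<open>a\<close> first, the mean of $e_k$ over these points is $1/p$
  times the number of roots modulo \<open>p\<close> of the polynomial $\sum_j k_j b^j$ in \<open>b\<close>
  (\<open>korobov_sum_chi\<close>). Removing the largest power of \<open>b\<close> that divides it costs at most
  the root \<open>b = 0\<close> and leaves a polynomial of degree below the width of the support of \<open>k\<close>.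
  So, unless \<open>p\<close> divides all $k_j$, the mean is at most the width divided by \<open>p\<close> (\<open>card_roots_freq_le_width\<close>), whatever the dimension.

  The frequencies all of whose entries are divisible by \<open>p\<close> are handled by averaging over the set \<open>P\<close> of all
  primes in $(m, 4m]$: the product of the bad primes divides every $k_j$, so there are at most
  $\min_j \log |k_j| / \log m$ of them. Hence the error on $e_k$ is at most \<open>weight d k\<close> times
  $1/(|P| \log m) + 1/m$ (\<open>sum_korobov_root_fractions_le\<close>). Bounds of Chebyshev type say that $|P|$ is of
  the exact order $m / \log m$ (\<open>card_window_primes_lower\<close>, \<open>card_window_primes_upper\<close>); with $m$ of
  order $1/\epsilon$ the error is at most \<open>\<epsilon>\<close>, and the number of points is of order
  $|P| m^2$, that is $\epsilon^{-3} / \log \epsilon^{-1}$.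
\<close>

section \<open>Prime numbers between $m$ and $4m$\<close>

text \<open>The numbers $1 / (k \binom nk)$ form the Leibniz harmonic triangle, in which each entry is the difference
  of two entries with smaller \<open>k\<close>. The first column consists of the $1/n$, so by induction
  every entry of the first \<open>N\<close> rows becomes an integer when multiplied by the least common multiple of
  \<open>{1..N}\<close>.\<close>

lemma leibniz_triangle_integral:
  fixes N k n :: nat
  assumes "1 \<le> k" "k \<le> n" "n \<le> N"
  shows "\<exists>z::int. real (Lcm {1..N}) / (real k * real (n choose k)) = of_int z"
  using assms
proof (induction k arbitrary: n rule: nat_induct_at_least)
  case base
  then have "n dvd Lcm {1..N}" by (intro dvd_Lcm) auto
  then obtain c where "Lcm {1..N} = n * c" by (elim dvdE)
  with base show ?case
    by (intro exI[of _ "int c"]) (simp add: field_simps)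
next
  case (Suc k)
  obtain m where n: "n = Suc m" using Suc.prems by (cases n) auto
  have km: "k \<le> m" using Suc.prems n by simp
  obtain z1 z2 :: int where
    z1: "real (Lcm {1..N}) / (real k * real (m choose k)) = of_int z1" and
    z2: "real (Lcm {1..N}) / (real k * real (n choose k)) = of_int z2"
    using Suc.IH[of m] Suc.IH[of n] Suc.prems n km by auto
  have pos: "real (m choose k) > 0" "real (n choose k) > 0" "real k > 0" using km n Suc.hyps by auto
  have a: "real (Suc k) * real (n choose Suc k) = real (Suc m) * real (m choose k)"
    using Suc_times_binomial[of k m] n by (metis of_nat_mult mult.commute)
  have "(Suc m - k) * (Suc m choose k) = Suc m * (m choose k)"
    using binomial_absorb_comp[of "Suc m" k] by simp
  then have "real (Suc m - k) * real (n choose k) = real (Suc m) * real (m choose k)"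
    using n by (metis of_nat_mult)
  then have b: "(real (Suc m) - real k) * real (n choose k) = real (Suc m) * real (m choose k)"
    using km by (simp add: of_nat_diff)
  have c: "real k / (real k * real (m choose k)) = 1 / real (m choose k)" using pos by simp
  have "1 / (real k * real (n choose k)) = (real (Suc m) - real k) / (real k * (real (Suc m) * real (m choose k)))"
    unfolding b[symmetric] using pos km n by (simp add: divide_simps del: of_nat_Suc)
  then have "1 / (real k * real (m choose k)) - 1 / (real k * real (n choose k))
     = 1 / (real (Suc m) * real (m choose k))"
    using pos km by (simp add: divide_simps del: of_nat_Suc) (simp add: algebra_simps)
  \<comment> \<open>the recursion of the triangle, multiplied by the least common multiple\<close>
  then have "real (Lcm {1..N}) / (real (Suc k) * real (n choose Suc k)) = of_int (z1 - z2)"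
    unfolding a of_int_diff z1[symmetric] z2[symmetric]
    by (metis (no_types, opaque_lifting) mult.right_neutral right_diff_distrib times_divide_eq_right)
  then show ?case by blast
qed

text \<open>For $n$ replaced by $2n$ and $k = n$ this gives an exponential lower bound for the least common
  multiple, which is the source of the lower bound on the number of primes.\<close>

lemma times_binomial_dvd_Lcm:
  fixes k n :: nat
  assumes "1 \<le> k" "k \<le> n"
  shows "k * (n choose k) dvd Lcm {1..n}"
proof -
  obtain z :: int where z: "real (Lcm {1..n}) / (real k * real (n choose k)) = of_int z"
    using leibniz_triangle_integral[OF assms order_refl] by blast
  have "real k * real (n choose k) > 0" using assms by simp
  then have "real (Lcm {1..n}) = of_int z * (real k * real (n choose k))"
    using z by (metis less_irrefl nonzero_eq_divide_eq)
  then have "of_int (int (Lcm {1..n})) = (of_int (z * int (k * (n choose k))) :: real)" by simp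
  then have "int (Lcm {1..n}) = z * int (k * (n choose k))" by (simp only: of_int_eq_iff)
  then have "int (k * (n choose k)) dvd int (Lcm {1..n})" by (metis dvd_triv_right)
  then show ?thesis by (simp only: int_dvd_int_iff)
qed

lemma Lcm_upto_ge:
  assumes "n \<ge> 1"
  shows "4 ^ n / 2 \<le> real (Lcm {1..2*n})"
proof -
  have "n * (2*n choose n) \<le> Lcm {1..2*n}"
    using times_binomial_dvd_Lcm[of n "2*n"] assms by (intro dvd_imp_le) (auto simp: Lcm_0_iff intro!: Nat.gr0I)
  then have "real n * real (2*n choose n) \<le> real (Lcm {1..2*n})"
    by (metis of_nat_le_iff of_nat_mult)
  moreover have "real n * (4^n / (2*real n)) \<le> real n * real (2*n choose n)"
    using central_binomial_lower_bound[of n] assms by (intro mult_left_mono) auto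
  ultimately show ?thesis using assms by simp
qed

lemma prime_power_multiplicity_Lcm_le:
  fixes p :: nat
  assumes "prime p" "n \<ge> 1"
  shows "p ^ multiplicity p (Lcm {1..n}) \<le> n"
  using assms(2)
proof (induction n rule: nat_induct_at_least)
  case base
  then show ?case by simp
next
  case (Suc n)
  have "{1..Suc n} = insert (Suc n) {1..n}" by auto
  then have "Lcm {1..Suc n} = lcm (Suc n) (Lcm {1..n})" by simp
  moreover have "Lcm {1..n} \<noteq> 0" by (auto simp: Lcm_0_iff)
  ultimately have "multiplicity p (Lcm {1..Suc n}) = max (multiplicity p (Suc n)) (multiplicity p (Lcm {1..n}))"
    using assms(1) by (simp add: multiplicity_lcm)
  moreover have "p ^ multiplicity p (Suc n) \<le> Suc n"
    by (intro dvd_imp_le multiplicity_dvd) auto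
  ultimately show ?case using Suc.IH by (simp add: max_def)
qed

text \<open>This is the Chebyshev function $\psi(n)$: a prime contributes the logarithm of its largest power
  not exceeding \<open>n\<close>.\<close>

lemma ln_Lcm_upto:
  assumes "n \<ge> 1"
  shows "ln (real (Lcm {1..n})) =
    (\<Sum>p | prime p \<and> p \<le> n. real (multiplicity p (Lcm {1..n})) * ln (real p))"
proof -
  let ?L = "Lcm {1..n}"
  have L0: "?L \<noteq> 0" by (auto simp: Lcm_0_iff)
  have sub: "prime_factors ?L \<subseteq> {p. prime p \<and> p \<le> n}"
  proof
    fix p assume p: "p \<in> prime_factors ?L"
    then have pp: "prime p" "p dvd ?L" by auto
    have "p ^ 1 \<le> p ^ multiplicity p ?L"
      using pp L0 prime_gt_0_nat[of p] by (intro power_increasing) (auto simp: multiplicity_geI prime_multiplicity_gt_zero_iff Suc_le_eq)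
    with prime_power_multiplicity_Lcm_le[OF pp(1) assms] pp show "p \<in> {p. prime p \<and> p \<le> n}" by simp
  qed
  have "?L = (\<Prod>p\<in>prime_factors ?L. p ^ multiplicity p ?L)"
    using prime_factorization_nat[of ?L] L0 by blast
  then have "ln (real ?L) = ln (\<Prod>p\<in>prime_factors ?L. real p ^ multiplicity p ?L)"
    by (metis (no_types, lifting) of_nat_power of_nat_prod prod.cong)
  also have "\<dots> = (\<Sum>p\<in>prime_factors ?L. ln (real p ^ multiplicity p ?L))"
    by (rule ln_prod) (auto intro: prime_gt_0_nat)
  also have "\<dots> = (\<Sum>p\<in>prime_factors ?L. real (multiplicity p ?L) * ln (real p))"
    by (rule sum.cong[OF refl], rule ln_realpow)
  also have "\<dots> = (\<Sum>p | prime p \<and> p \<le> n. real (multiplicity p ?L) * ln (real p))"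
    using sub by (intro sum.mono_neutral_left)
      (auto simp: prime_factors_multiplicity)
  finally show ?thesis .
qed

definition chebyshev_theta :: "nat \<Rightarrow> real" where
  "chebyshev_theta n = (\<Sum>p | prime p \<and> p \<le> n. ln (real p))"

lemma finite_primes_le [simp]: "finite {p::nat. prime p \<and> p \<le> n}"
  by (rule finite_subset[of _ "{..n}"]) auto

lemma prod_primes_dvd:
  fixes n :: nat
  assumes "finite P" "\<And>p. p \<in> P \<Longrightarrow> prime p" "\<And>p. p \<in> P \<Longrightarrow> p dvd n"
  shows "\<Prod>P dvd n"
  using assms
proof (induction P rule: finite_induct)
  case (insert p P)
  have "coprime p (\<Prod>P)"
    using insert.hyps insert.prems(1) by (intro prod_coprime_right) (metis insertCI primes_coprime)
  with insert show ?case by (simp add: divides_mult)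
qed simp

text \<open>Every prime in $(m+1, 2m+1]$ divides $\binom{2m+1}{m}$, which is at most $4^m$ because
  it occurs twice in row \<open>2*m+1\<close> of the Pascal triangle.\<close>

lemma chebyshev_theta_double_le: "chebyshev_theta (2*m+1) \<le> chebyshev_theta (m+1) + real m * ln 4"
proof -
  let ?P = "{p::nat. prime p \<and> m + 1 < p \<and> p \<le> 2*m+1}"
  have fin: "finite ?P" by (rule finite_subset[of _ "{..2*m+1}"]) auto
  have ln0: "ln (real p) \<ge> 0" if "prime p" for p using prime_ge_1_nat[OF that] by simp
  have dvd: "p dvd (2*m+1 choose m)" if "p \<in> ?P" for p
  proof -
    have "fact m * fact (m+1) * (2*m+1 choose m) = (fact (2*m+1) :: nat)"
      using binomial_fact_lemma[of m "2*m+1"] by simp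
    moreover have "p dvd (fact (2*m+1) :: nat)" using that by (simp add: prime_dvd_fact_iff del: fact_Suc)
    moreover have "\<not> p dvd (fact m :: nat)" "\<not> p dvd (fact (m+1) :: nat)"
      using that by (simp_all add: prime_dvd_fact_iff del: fact_Suc)
    ultimately show ?thesis using that by (metis (no_types, lifting) mem_Collect_eq prime_dvd_mult_iff)
  qed
  have "\<Prod>?P dvd (2*m+1 choose m)"
    using dvd fin by (intro prod_primes_dvd) auto
  then have "\<Prod>?P \<le> (2*m+1 choose m)" by (intro dvd_imp_le) auto
  also have "(2*m+1 choose m) \<le> 4 ^ m"
    using binomial_r_part_sum[of m] member_le_sum[of m "{..m}" "\<lambda>k. 2*m+1 choose k"]
    by (simp add: power_mult)
  finally have "real (\<Prod>?P) \<le> 4 ^ m" by (metis of_nat_le_iff of_nat_numeral of_nat_power)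
  then have "ln (real (\<Prod>?P)) \<le> ln (4 ^ m)"
    by (subst ln_le_cancel_iff) (auto intro!: prod_pos prime_gt_0_nat)
  also have "ln (real (\<Prod>?P)) = (\<Sum>p\<in>?P. ln (real p))"
    unfolding of_nat_prod by (intro ln_prod) (auto intro: prime_gt_0_nat)
  finally have 1: "(\<Sum>p\<in>?P. ln (real p)) \<le> real m * ln 4" by (simp add: ln_realpow)
  have "{p::nat. prime p \<and> p \<le> 2*m+1} = {p. prime p \<and> p \<le> m+1} \<union> ?P" by auto
  then have "chebyshev_theta (2*m+1) = chebyshev_theta (m+1) + (\<Sum>p\<in>?P. ln (real p))"
    unfolding chebyshev_theta_def by (simp only:) (intro sum.union_disjoint, auto simp: fin)
  with 1 show ?thesis by simp
qed

lemma chebyshev_theta_le: "chebyshev_theta n \<le> real n * ln 4"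
proof (induction n rule: less_induct)
  case (less n)
  have "n \<le> 1 \<or> n = 2 \<or> n > 2 \<and> even n \<or> n > 2 \<and> odd n" by arith
  then consider "n \<le> 1" | "n = 2" | "n > 2" "even n" | "n > 2" "odd n" by blast
  then show ?case
  proof cases
    case 1
    then have "{p::nat. prime p \<and> p \<le> n} = {}" using not_prime_1 not_prime_0 by (auto simp: le_Suc_eq)
    then show ?thesis unfolding chebyshev_theta_def by (simp only: sum.empty) simp
  next
    case 2
    have "{p::nat. prime p \<and> p \<le> 2} = {2}" by (auto dest: prime_ge_2_nat)
    then show ?thesis using 2 ln_realpow[of 2 2] by (simp add: chebyshev_theta_def)
  next
    case 3
    have "\<not> prime n" using 3 primes_dvd_imp_eq two_is_prime_nat by blast
    then have "{p::nat. prime p \<and> p \<le> n} = {p. prime p \<and> p \<le> n - 1}"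
      using \<open>n > 2\<close> by (auto simp: le_eq_less_or_eq)
    then have "chebyshev_theta n = chebyshev_theta (n - 1)" by (simp add: chebyshev_theta_def)
    also have "\<dots> \<le> real (n-1) * ln 4" using less[of "n-1"] 3 by simp
    also have "\<dots> \<le> real n * ln 4" by (intro mult_right_mono) auto
    finally show ?thesis .
  next
    case 4
    then obtain m where m: "n = 2*m+1" by (elim oddE)
    have "chebyshev_theta n \<le> chebyshev_theta (m+1) + real m * ln 4" unfolding m by (rule chebyshev_theta_double_le)
    also have "chebyshev_theta (m+1) \<le> real (m+1) * ln 4" using less[of "m+1"] m 4 by simp
    finally show ?thesis using m by (simp add: algebra_simps)
  qed
qed

text \<open>The ratio 4 of the end points is large enough for the crude bounds \<open>Lcm_upto_ge\<close> and \<open>chebyshev_theta_le\<close> to produce primes: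
  up to smaller terms $\log \mathrm{lcm}(1,\ldots,4m) \ge 2 m \log 4$, whereas the primes up to \<open>m\<close> account for at
  most $m \log 4$.\<close>

abbreviation window_primes :: "nat \<Rightarrow> nat set" where
  "window_primes m \<equiv> {p. prime p \<and> m < p \<and> p \<le> 4*m}"

lemma card_window_primes_upper:
  assumes "m \<ge> 1"
  shows "real (card (window_primes m)) * ln (real m) \<le> 6 * real m"
proof -
  have "real (card (window_primes m)) * ln (real m) = (\<Sum>p\<in>window_primes m. ln (real m))" by simp
  also have "\<dots> \<le> (\<Sum>p\<in>window_primes m. ln (real p))" using assms by (intro sum_mono) auto
  also have "\<dots> \<le> chebyshev_theta (4*m)"
    unfolding chebyshev_theta_def using prime_ge_1_nat by (intro sum_mono2) auto
  also have "\<dots> \<le> real (4*m) * ln 4" by (rule chebyshev_theta_le)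
  also have "ln (4::real) \<le> 3/2"
  proof -
    have "ln (4::real) = 2 * ln 2" using ln_realpow[of 2 2] by simp
    then show ?thesis using ln2_le_25_over_36 by simp
  qed
  then have "real (4*m) * ln 4 \<le> real (4*m) * (3/2)" by (intro mult_left_mono) auto
  finally show ?thesis by simp
qed

text \<open>In $\psi(4m)$ the primes up to $2\sqrt m$ contribute at most $\log (4m)$ each, which is negligible in total,
  the other primes up to \<open>m\<close> contribute at most $\vartheta(m) \le m \log 4$, and each prime of the window
  contributes at most $\log (4m)$. Since $\psi(4m)$ is about $2 m \log 4$ or more, the window must contribute a
  multiple of \<open>m\<close>.\<close>

lemma card_window_primes_lower:
  "eventually (\<lambda>m. real m \<le> 2 * real (card (window_primes m)) * ln (real m)) sequentially"
proof -
  have ev: "eventually (\<lambda>m::nat. ln 2 + 2 * sqrt (real m) * ln (4 * real m) \<le> real m / 4) sequentially"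
    by real_asymp
  show ?thesis
    using ev eventually_ge_at_top[of 4]
  proof eventually_elim
    case (elim m)
    let ?N = "4*m" and ?l = "ln (4 * real m)"
    let ?L = "Lcm {1..4*m}"
    let ?A = "{p::nat. prime p \<and> p \<le> ?N \<and> p * p \<le> ?N}"
    let ?e = "\<lambda>p. real (multiplicity p ?L) * ln (real p)"
    have l0: "?l \<ge> 0" using elim by simp
    \<comment> \<open>prime powers dividing the least common multiple do not exceed \<open>4*m\<close>\<close>
    have e_le: "?e p \<le> ?l" if "prime p" for p
    proof -
      have "real (p ^ multiplicity p ?L) \<le> real ?N"
        using prime_power_multiplicity_Lcm_le[OF that, of ?N] elim by (simp only: of_nat_le_iff)
      then have "ln (real p ^ multiplicity p ?L) \<le> ln (real ?N)"
        using prime_gt_0_nat[OF that] elim by (subst ln_le_cancel_iff) auto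
      then show ?thesis using prime_gt_0_nat[OF that] by (simp add: ln_realpow)
    qed
    \<comment> \<open>primes above the square root of \<open>4*m\<close> enter at most once\<close>
    have e_le': "?e p \<le> ln (real p)" if "prime p" "p \<notin> ?A" "p \<le> ?N" for p
    proof -
      have "multiplicity p ?L \<le> 1"
      proof (rule ccontr)
        assume "\<not> multiplicity p ?L \<le> 1"
        then have "p ^ 2 \<le> p ^ multiplicity p ?L"
          using prime_gt_0_nat[OF that(1)] by (intro power_increasing) auto
        with prime_power_multiplicity_Lcm_le[OF that(1), of ?N] elim have "p ^ 2 \<le> ?N" by linarith
        with that show False by (simp add: power2_eq_square)
      qed
      then show ?thesis using prime_ge_1_nat[OF that(1)]
        by (intro mult_left_le_one_le) auto
    qed
    have cardA: "real (card ?A) \<le> 2 * sqrt (real m)"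
    proof -
      have "?A \<subseteq> {1..nat \<lfloor>2 * sqrt (real m)\<rfloor>}"
      proof
        fix p assume p: "p \<in> ?A"
        then have "real (p*p) \<le> real (4*m)" by (simp only: mem_Collect_eq of_nat_le_iff)
        then have "sqrt (real p ^ 2) \<le> sqrt (4 * real m)" 
          by (intro real_sqrt_le_mono) (simp add: power2_eq_square)
        then have "real p \<le> 2 * sqrt (real m)" by (simp add: real_sqrt_mult)
        then show "p \<in> {1..nat \<lfloor>2 * sqrt (real m)\<rfloor>}"
          using p prime_ge_1_nat by (simp add: le_nat_floor)
      qed
      then have "card ?A \<le> card {1..nat \<lfloor>2 * sqrt (real m)\<rfloor>}"
        by (rule card_mono[OF finite_atLeastAtMost])
      then have "real (card ?A) \<le> real (nat \<lfloor>2 * sqrt (real m)\<rfloor>)"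
        by (simp only: card_atLeastAtMost diff_Suc_1 of_nat_le_iff)
      also have "\<dots> \<le> 2 * sqrt (real m)" by (intro of_nat_floor) simp
      finally show ?thesis .
    qed
    have "4 ^ (2*m) / 2 \<le> real ?L" using Lcm_upto_ge[of "2*m"] elim by simp
    then have "ln (4 ^ (2*m) / 2) \<le> ln (real ?L)"
      by (subst ln_le_cancel_iff) (auto simp: Lcm_0_iff intro!: Nat.gr0I)
    then have lower: "2 * real m * ln 4 - ln 2 \<le> ln (real ?L)"
      by (simp add: ln_div ln_realpow)
    have fA: "finite ?A" by (rule finite_subset[of _ "{..?N}"]) auto
    have fD: "finite (window_primes m)" by (rule finite_subset[of _ "{..?N}"]) auto
    have "ln (real ?L) = (\<Sum>p | prime p \<and> p \<le> ?N. ?e p)" using ln_Lcm_upto[of ?N] elim by simp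
    also have "\<dots> \<le> (\<Sum>p\<in>{p. prime p \<and> p \<le> ?N}. (if p \<in> ?A then ?l else 0) +
        (if p \<le> m then ln (real p) else 0) + (if p \<in> window_primes m then ?l else 0))"
    proof (rule sum_mono)
      fix p assume "p \<in> {p. prime p \<and> p \<le> ?N}"
      then have p: "prime p" "p \<le> ?N" by auto
      then have "ln (real p) \<ge> 0" using prime_ge_1_nat by simp
      then show "?e p \<le> (if p \<in> ?A then ?l else 0) +
        (if p \<le> m then ln (real p) else 0) + (if p \<in> window_primes m then ?l else 0)"
        using e_le[OF p(1)] e_le'[OF p(1) _ p(2)] l0 p by (cases "p \<in> ?A") auto
    qed
    also have "\<dots> = real (card ?A) * ?l + chebyshev_theta m + real (card (window_primes m)) * ?l"
    proof -
      have "{p. prime p \<and> p \<le> ?N} \<inter> ?A = ?A" "{p. prime p \<and> p \<le> ?N} \<inter> window_primes m = window_primes m"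
        "{p. prime p \<and> p \<le> ?N} \<inter> {p. p \<le> m} = {p. prime p \<and> p \<le> m}" by auto
      then show ?thesis unfolding chebyshev_theta_def
        by (simp add: sum.distrib sum.If_cases del: mem_Collect_eq)
    qed
    also have "chebyshev_theta m \<le> real m * ln 4" by (rule chebyshev_theta_le)
    also have "real (card ?A) * ?l \<le> 2 * sqrt (real m) * ?l"
      using cardA l0 by (rule mult_right_mono)
    finally have *: "real m * ln 4 \<le> real (card (window_primes m)) * ?l + (ln 2 + 2 * sqrt (real m) * ?l)"
      using lower by (simp add: algebra_simps)
    have "ln (4::real) = 2 * ln 2" using ln_realpow[of 2 2] by simp
    moreover have "ln (2::real) \<ge> 5/8" using ln2_ge_two_thirds by simp
    ultimately have "real m * (5/4) \<le> real m * ln 4" by (intro mult_left_mono) auto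
    with * elim have "real m \<le> real (card (window_primes m)) * ?l" by linarith
    also have "?l \<le> 2 * ln (real m)"
    proof -
      have "?l = ln 4 + ln (real m)" using elim by (subst ln_mult) auto
      also have "ln 4 \<le> ln (real m)" using elim by simp
      finally show ?thesis by simp
    qed
    then have "real (card (window_primes m)) * ?l \<le> real (card (window_primes m)) * (2 * ln (real m))"
      by (intro mult_left_mono) auto
    finally show ?case by (simp add: mult_ac)
  qed
qed

section \<open>Exponential sums over the point sets\<close>

text \<open>Lagrange's bound over the field of residues modulo \<open>p\<close>, proved by splitting off linear factors from
  integer polynomials so that no residue field has to be constructed.\<close>

lemma card_poly_roots_mod_prime_le:
  fixes f :: "int poly" and p :: int
  assumes "prime p" "degree f \<le> n" "\<not> p dvd coeff f i"
  shows "card {b \<in> {0..<p}. p dvd poly f b} \<le> n"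
  using assms(2,3)
proof (induction n arbitrary: f i)
  case 0
  then obtain c where f: "f = [:c:]" by (metis degree_0_id le_zero_eq)
  then have "\<not> p dvd c" using 0 by (cases i) auto
  with f show ?case by simp
next
  case (Suc n)
  let ?R = "\<lambda>f. {b \<in> {0..<p}. p dvd poly f b}"
  show ?case
  proof (cases "?R f = {}")
    case True
    then show ?thesis by (simp only: card.empty)
  next
    case False
    then obtain a where a: "a \<in> {0..<p}" "p dvd poly f a" by blast
    define g where "g = synthetic_div f a"
    have f: "f = [:-a, 1:] * g + [:poly f a:]"
      using synthetic_div_correct'[of a f] by (simp add: g_def)
    have deg: "degree g \<le> n" using Suc.prems(1) by (simp add: g_def degree_synthetic_div)
    have "\<exists>j. \<not> p dvd coeff g j"
    proof (rule ccontr)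
      assume "\<nexists>j. \<not> p dvd coeff g j"
      then have "p dvd coeff ([:-a, 1:] * g) i" by (cases i) (auto simp: coeff_pCons)
      moreover have "p dvd coeff [:poly f a:] i" using a(2) by (cases i) auto
      ultimately have "p dvd coeff ([:-a, 1:] * g + [:poly f a:]) i" by simp
      with f Suc.prems(2) show False by simp
    qed
    then obtain j where "\<not> p dvd coeff g j" by blast
    with Suc.IH deg have card_g: "card (?R g) \<le> n" by blast
    have fin_g: "finite (?R g)" by (rule finite_subset[of _ "{0..<p}"]) auto
    have "?R f \<subseteq> insert a (?R g)"
    proof
      fix b assume b: "b \<in> ?R f"
      have "poly f b = (b - a) * poly g b + poly f a"
        by (subst f) (simp add: algebra_simps)
      then have "p dvd (b - a) * poly g b" using a(2) b by (simp add: dvd_add_left_iff)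
      then have "p dvd b - a \<or> p dvd poly g b" using assms(1) by (simp add: prime_dvd_mult_iff)
      moreover have "b = a" if "p dvd b - a"
        using that a(1) b by (metis (lifting) atLeastLessThan_iff mem_Collect_eq mod_eq_dvd_iff mod_pos_pos_trivial)
      ultimately show "b \<in> insert a (?R g)" using b by blast
    qed
    then have "card (?R f) \<le> card (insert a (?R g))" using fin_g by (intro card_mono) auto
    also have "\<dots> \<le> Suc (card (?R g))" using fin_g by (simp add: card_insert_if)
    finally show ?thesis using card_g by simp
  qed
qed

text \<open>With \<open>m\<close> the least index of the support, the sum is $b^m$ times a polynomial of degree at most
  the width minus one. The root \<open>b = 0\<close> of the first factor uses up the remaining one.\<close>

lemma card_roots_freq_le_width:
  fixes p :: nat and k :: "nat \<Rightarrow> int"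
  assumes "prime p" "j0 \<in> {1..d}" "\<not> int p dvd k j0"
  shows "card {b \<in> {..<p}. int p dvd (\<Sum>j=1..d. k j * int b ^ j)} \<le> width (supp d k)"
proof -
  let ?S = "supp d k" and ?p = "int p"
  have pp: "prime ?p" using assms(1) by simp
  have j0: "j0 \<in> ?S" using assms by (auto simp: supp_def)
  have fin: "finite ?S" by (simp add: supp_def)
  define m where "m = Min ?S"
  define w where "w = Max ?S - m"
  have m: "m \<le> j" "j - m \<le> w" if "j \<in> ?S" for j
    using that fin by (auto simp: m_def w_def intro!: diff_le_mono)
  define f where "f = (\<Sum>j\<in>?S. monom (k j) (j - m))"
  have deg: "degree f \<le> w"
    unfolding f_def using m fin by (intro degree_sum_le) (auto intro: order_trans[OF degree_monom_le])
  have "coeff f (j0 - m) = (\<Sum>j\<in>?S. if j = j0 then k j else 0)"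
    unfolding f_def coeff_sum using m j0 by (intro sum.cong) (auto simp: eq_diff_iff)
  then have "coeff f (j0 - m) = k j0" using j0 fin by simp
  with card_poly_roots_mod_prime_le[OF pp deg, of "j0 - m"] assms(3)
  have card_f: "card {b \<in> {0..<?p}. ?p dvd poly f b} \<le> w" by simp
  have factor: "(\<Sum>j=1..d. k j * b ^ j) = b ^ m * poly f b" for b :: int
  proof -
    have "(\<Sum>j=1..d. k j * b ^ j) = (\<Sum>j\<in>?S. k j * b ^ j)"
      by (intro sum.mono_neutral_right) (auto simp: supp_def)
    also have "\<dots> = (\<Sum>j\<in>?S. b ^ m * (k j * b ^ (j - m)))"
    proof (intro sum.cong refl)
      fix j assume "j \<in> ?S"
      then have "b ^ j = b ^ m * b ^ (j - m)" using m(1) by (simp flip: power_add)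
      then show "k j * b ^ j = b ^ m * (k j * b ^ (j - m))" by simp
    qed
    also have "\<dots> = b ^ m * poly f b"
      by (simp add: f_def poly_sum poly_monom sum_distrib_left)
    finally show ?thesis .
  qed
  have "int ` {b \<in> {..<p}. ?p dvd (\<Sum>j=1..d. k j * int b ^ j)}
      \<subseteq> insert 0 {b \<in> {0..<?p}. ?p dvd poly f b}"
  proof (intro subsetI, elim imageE)
    fix c b assume c: "c = int b" and "b \<in> {b \<in> {..<p}. ?p dvd (\<Sum>j=1..d. k j * int b ^ j)}"
    then have b: "b < p" "?p dvd int b ^ m * poly f (int b)" unfolding factor by auto
    then have "?p dvd int b ^ m \<or> ?p dvd poly f (int b)" using pp by (simp add: prime_dvd_mult_iff)
    then have "?p dvd int b \<or> ?p dvd poly f (int b)" using pp prime_dvd_power by blast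
    moreover have "b = 0" if "?p dvd int b" using that b(1) by (auto dest: nat_dvd_not_less)
    ultimately show "c \<in> insert 0 {b \<in> {0..<?p}. ?p dvd poly f b}" using b(1) c by auto
  qed
  moreover have fin_f: "finite {b \<in> {0..<?p}. ?p dvd poly f b}"
    by (rule finite_subset[of _ "{0..<?p}"]) auto
  ultimately have "card (int ` {b \<in> {..<p}. ?p dvd (\<Sum>j=1..d. k j * int b ^ j)})
      \<le> card (insert 0 {b \<in> {0..<?p}. ?p dvd poly f b})"
    by (intro card_mono) auto
  also have "\<dots> \<le> Suc (card {b \<in> {0..<?p}. ?p dvd poly f b})" using fin_f by (simp add: card_insert_if)
  also have "\<dots> \<le> Suc w" using card_f by simp
  also have "\<dots> = width ?S" using j0 by (auto simp: width_def w_def m_def)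
  finally show ?thesis by (simp add: card_image)
qed

text \<open>Since the frequency enters only through its values on \<open>{1..d}\<close>, arbitrary functions are allowed
  as frequencies here; this makes them closed under pointwise addition.\<close>

definition chi :: "nat \<Rightarrow> (nat \<Rightarrow> int) \<Rightarrow> (nat \<Rightarrow> real) \<Rightarrow> complex" where
  "chi d k x = cis (2 * pi * (\<Sum>j=1..d. of_int (k j) * x j))"

definition korobov_point :: "nat \<Rightarrow> nat \<Rightarrow> nat \<Rightarrow> nat \<Rightarrow> nat \<Rightarrow> real" where
  "korobov_point d p a b = (\<lambda>j\<in>{1..d}. frac (real (a * b ^ j) / real p))"

lemma korobov_point_in_cube: "korobov_point d p a b \<in> cube d"
  by (auto simp: korobov_point_def cube_def frac_lt_1)

lemma cis_2pi_int: "cis (2 * pi * of_int n) = 1"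
  by (metis cis_multiple_2pi Ints_of_int mult.commute mult.assoc)

text \<open>Passing to fractional parts changes the phase by an integer multiple of $2\pi$, so the points behave like a
  geometric progression in \<open>a\<close>.\<close>

lemma chi_korobov_point:
  assumes "p > 0"
  shows "chi d k (korobov_point d p a b) =
    cis (2 * pi * of_int (\<Sum>j=1..d. k j * int b ^ j) / real p) ^ a"
proof -
  let ?s = "\<Sum>j=1..d. k j * int b ^ j"
  let ?fl = "\<Sum>j=1..d. k j * \<lfloor>real (a * b ^ j) / real p\<rfloor>"
  have "(\<Sum>j=1..d. of_int (k j) * korobov_point d p a b j)
     = (\<Sum>j=1..d. real a * (of_int (k j) * real b ^ j / real p) - of_int (k j * \<lfloor>real (a * b ^ j) / real p\<rfloor>))"
    by (intro sum.cong) (auto simp: korobov_point_def frac_def algebra_simps)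
  also have "\<dots> = real a * (of_int ?s / real p) - of_int ?fl"
    by (simp add: sum_subtractf sum_distrib_left sum_divide_distrib)
  finally have "2 * pi * (\<Sum>j=1..d. of_int (k j) * korobov_point d p a b j)
     = 2 * pi * (real a * (of_int ?s / real p) - of_int ?fl)" by simp
  also have "\<dots> = real a * (2 * pi * of_int ?s / real p) - 2 * pi * of_int ?fl"
    by (simp only: right_diff_distrib) (simp only: mult_ac times_divide_eq_right)
  finally have *: "2 * pi * (\<Sum>j=1..d. of_int (k j) * korobov_point d p a b j)
     = real a * (2 * pi * of_int ?s / real p) - 2 * pi * of_int ?fl" .
  show ?thesis unfolding chi_def * by (simp only: cis_divide[symmetric] cis_2pi_int Complex.DeMoivre div_by_1)
qed

lemma sum_cis_roots_of_unity:
  assumes "p > 0"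
  shows "(\<Sum>a<p. cis (2 * pi * of_int s / real p) ^ a) = (if int p dvd s then of_nat p else 0)"
proof -
  let ?z = "cis (2 * pi * of_int s / real p)"
  have "?z ^ p = cis (real p * (2 * pi * of_int s / real p))" by (rule Complex.DeMoivre)
  also have "real p * (2 * pi * of_int s / real p) = 2 * pi * of_int s" using assms by simp
  finally have "?z ^ p = cis (2 * pi * of_int s)" .
  then have zp: "?z ^ p = 1" by (simp add: cis_2pi_int)
  show ?thesis
  proof (cases "int p dvd s")
    case True
    then obtain t where "s = int p * t" by (elim dvdE)
    then have "?z = 1" using assms cis_2pi_int[of t] by (simp add: mult.assoc)
    then show ?thesis using True by simp
  next
    case False
    have "?z \<noteq> 1"
    proof
      assume "?z = 1"
      then have "cos (2 * pi * of_int s / real p) = 1" by (metis cis.sel(1) one_complex.sel(1))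
      then obtain t :: int where "2 * pi * of_int s / real p = of_int t * 2 * pi"
        by (auto simp: cos_one_2pi_int)
      then have "real_of_int s = of_int (t * int p)" using assms by (simp add: field_simps)
      then have "s = t * int p" by (simp only: of_int_eq_iff)
      with False show False by simp
    qed
    then show ?thesis using zp False by (simp add: geometric_sum)
  qed
qed

text \<open>Summation over \<open>a\<close> selects, by the orthogonality of roots of unity, exactly the \<open>b\<close> that are roots of
  the polynomial with coefficients \<open>k\<close>.\<close>

lemma korobov_sum_chi:
  assumes "p > 0"
  shows "(\<Sum>a<p. \<Sum>b<p. chi d k (korobov_point d p a b)) =
    of_nat (p * card {b \<in> {..<p}. int p dvd (\<Sum>j=1..d. k j * int b ^ j)})"
proof -
  have "(\<Sum>a<p. \<Sum>b<p. chi d k (korobov_point d p a b))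
     = (\<Sum>b<p. \<Sum>a<p. chi d k (korobov_point d p a b))" by (rule sum.swap)
  also have "\<dots> = (\<Sum>b<p. if int p dvd (\<Sum>j=1..d. k j * int b ^ j) then of_nat p else 0)"
    by (simp only: chi_korobov_point[OF assms] sum_cis_roots_of_unity[OF assms])
  also have "\<dots> = of_nat (p * card {b \<in> {..<p}. int p dvd (\<Sum>j=1..d. k j * int b ^ j)})"
    by (simp add: sum.If_cases Collect_conj_eq lessThan_def mult.commute)
  finally show ?thesis .
qed

section \<open>Characters and trigonometric polynomials on the cube\<close>

abbreviation unit_measure :: "real measure" where
  "unit_measure \<equiv> restrict_space lborel {0..<1}"

lemma prob_space_unit_measure: "prob_space unit_measure"
  by (rule prob_spaceI) (simp add: emeasure_restrict_space space_restrict_space)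

interpretation unit: prob_space unit_measure
  by (rule prob_space_unit_measure)

interpretation unit_product: product_sigma_finite "\<lambda>_::nat. unit_measure"
  by unfold_locales

lemma prob_space_cube_measure: "prob_space (cube_measure d)"
  unfolding cube_measure_def by (intro prob_space_PiM prob_space_unit_measure)

lemma space_cube_measure [simp]: "space (cube_measure d) = cube d"
  by (simp add: cube_measure_def cube_def space_PiM space_restrict_space)

lemma measurable_cube_coordinate:
  assumes "j \<in> {1..d}"
  shows "(\<lambda>x. x j) \<in> borel_measurable (cube_measure d)"
proof -
  have "(\<lambda>x. x j) \<in> measurable (cube_measure d) unit_measure"
    unfolding cube_measure_def using assms by (rule measurable_component_singleton)
  moreover have "(\<lambda>t. t) \<in> measurable unit_measure borel"
    by (intro measurable_restrict_space1) simp
  ultimately show ?thesis by (rule measurable_compose)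
qed

lemma measurable_cis [measurable]: "cis \<in> borel_measurable borel"
  by (intro borel_measurable_continuous_onI continuous_intros)

lemma cis_sum: "finite A \<Longrightarrow> cis (sum f A) = (\<Prod>i\<in>A. cis (f i))"
  by (induction A rule: finite_induct) (simp_all flip: cis_mult)

lemma measurable_chi [measurable]: "chi d k \<in> borel_measurable (cube_measure d)"
proof -
  have "(\<lambda>x. 2 * pi * (\<Sum>j=1..d. of_int (k j) * x j)) \<in> borel_measurable (cube_measure d)"
    by (intro borel_measurable_times borel_measurable_sum borel_measurable_const measurable_cube_coordinate)
  then have "(\<lambda>x. cis (2 * pi * (\<Sum>j=1..d. of_int (k j) * x j))) \<in> borel_measurable (cube_measure d)"
    by (rule measurable_compose[OF _ measurable_cis])
  then show ?thesis by (simp add: chi_def[abs_def])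
qed

lemma norm_chi [simp]: "norm (chi d k x) = 1"
  by (simp add: chi_def)

lemma chi_mult: "chi d k x * chi d l x = chi d (\<lambda>j. k j + l j) x"
  by (simp add: chi_def cis_mult algebra_simps sum.distrib)

lemma continuous_on_chi: "continuous_on A (chi d k)"
  unfolding chi_def[abs_def]
  by (intro continuous_intros continuous_on_subset[OF continuous_on_product_coordinates] subset_UNIV)

lemma integrable_mult_chi:
  assumes "integrable (cube_measure d) h"
  shows "integrable (cube_measure d) (\<lambda>x. h x * chi d k x)"
  using assms(1)
  by (rule Bochner_Integration.integrable_bound) (use assms in \<open>auto simp: norm_mult\<close>)

lemma integrable_chi: "integrable (cube_measure d) (chi d k)"
proof -
  interpret prob_space "cube_measure d" by (rule prob_space_cube_measure)
  show ?thesis by (rule integrable_const_bound[of _ 1]) auto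
qed

lemma integral_unit_cis:
  "(\<integral>t. cis (2 * pi * (of_int n * t)) \<partial>unit_measure) = (if n = 0 then 1 else 0)"
proof (cases "n = 0")
  case True
  then show ?thesis using unit.prob_space by simp
next
  case False
  let ?w = "2 * pi * of_int n :: real"
  let ?F = "\<lambda>t. cis (?w * t) / (\<i> * of_real ?w)"
  have w: "?w \<noteq> 0" using False by simp
  have "(\<integral>t. cis (?w * t) \<partial>unit_measure) = (\<integral>t. indicator {0..<1} t *\<^sub>R cis (?w * t) \<partial>lborel)"
    by (subst integral_restrict_space) auto
  also have "\<dots> = (\<integral>t. indicator {0..1} t *\<^sub>R cis (?w * t) \<partial>lborel)"
  proof (rule integral_cong_AE)
    show "AE t in lborel. indicator {0..<1} t *\<^sub>R cis (?w * t) = indicator {0..1} t *\<^sub>R cis (?w * t)"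
      using AE_lborel_singleton[of "1::real"] by eventually_elim (auto simp: indicator_def)
  qed measurable
  also have "\<dots> = ?F 1 - ?F 0"
  proof (rule integral_FTC_Icc)
    fix t :: real
    have "((\<lambda>t. cis (?w * t)) has_vector_derivative ?w *\<^sub>R (\<i> * cis (?w * t))) (at t within {0..1})"
      unfolding has_vector_derivative_def
      by (rule has_derivative_eq_rhs, rule has_derivative_cis, rule has_derivative_mult_right,
          rule has_derivative_ident) (auto simp: fun_eq_iff)
    then have "(?F has_vector_derivative (?w *\<^sub>R (\<i> * cis (?w * t))) / (\<i> * of_real ?w)) (at t within {0..1})"
      by (rule has_vector_derivative_divide)
    moreover have "(?w *\<^sub>R (\<i> * cis (?w * t))) / (\<i> * of_real ?w) = cis (?w * t)"
      using w by (simp add: scaleR_conv_of_real)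
    ultimately show "(?F has_vector_derivative cis (?w * t)) (at t within {0..1})" by simp
  next
    show "continuous_on {0..1} (\<lambda>t. cis (?w * t))" by (intro continuous_intros)
  qed simp
  also have "\<dots> = 0" using cis_2pi_int[of n] by simp
  finally show ?thesis using False by (simp add: mult.assoc)
qed

lemma integral_chi:
  "(\<integral>x. chi d k x \<partial>cube_measure d) = (if \<forall>j\<in>{1..d}. k j = 0 then 1 else 0)"
proof -
  have int: "integrable unit_measure (\<lambda>t. cis (2 * pi * (of_int (k j) * t)))" for j
    by (rule unit.integrable_const_bound[of _ 1]) (auto intro!: measurable_restrict_space1)
  have "chi d k x = (\<Prod>j\<in>{1..d}. cis (2 * pi * (of_int (k j) * x j)))" for x
    by (simp add: chi_def cis_sum sum_distrib_left)
  then have "(\<integral>x. chi d k x \<partial>cube_measure d)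
     = (\<integral>x. (\<Prod>j\<in>{1..d}. cis (2 * pi * (of_int (k j) * x j))) \<partial>Pi\<^sub>M {1..d} (\<lambda>_. unit_measure))"
    by (simp only: cube_measure_def)
  also have "\<dots> = (\<Prod>j\<in>{1..d}. \<integral>t. cis (2 * pi * (of_int (k j) * t)) \<partial>unit_measure)"
    using int by (intro unit_product.product_integral_prod) auto
  also have "\<dots> = (\<Prod>j\<in>{1..d}. if k j = 0 then 1 else 0)" by (simp only: integral_unit_cis)
  also have "\<dots> = (if \<forall>j\<in>{1..d}. k j = 0 then 1 else 0)" by auto
  finally show ?thesis .
qed

text \<open>The span of the characters, generated by its closure properties so that the orthogonality of a function to all
  characters extends to it by rule induction.\<close>

inductive_set trig_polys :: "nat \<Rightarrow> ((nat \<Rightarrow> real) \<Rightarrow> complex) set" for d where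
  monomial: "(\<lambda>x. c * chi d k x) \<in> trig_polys d"
| add: "f \<in> trig_polys d \<Longrightarrow> g \<in> trig_polys d \<Longrightarrow> (\<lambda>x. f x + g x) \<in> trig_polys d"

lemma trig_polys_const: "(\<lambda>x. c) \<in> trig_polys d"
  using trig_polys.monomial[of c d "\<lambda>_. 0"] by (simp add: chi_def)

lemma trig_polys_monomial_mult:
  assumes "g \<in> trig_polys d"
  shows "(\<lambda>x. c * chi d k x * g x) \<in> trig_polys d"
  using assms
proof induction
  case (monomial e l)
  have "(\<lambda>x. c * chi d k x * (e * chi d l x)) = (\<lambda>x. (c * e) * chi d (\<lambda>j. k j + l j) x)"
    by (simp add: chi_mult[symmetric] mult_ac)
  then show ?case by (simp only: trig_polys.monomial)
next
  case (add f g)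
  then show ?case by (simp only: distrib_left trig_polys.add)
qed

lemma trig_polys_mult:
  assumes "f \<in> trig_polys d" "g \<in> trig_polys d"
  shows "(\<lambda>x. f x * g x) \<in> trig_polys d"
  using assms(1)
proof induction
  case (monomial c k)
  then show ?case using trig_polys_monomial_mult[OF assms(2)] by simp
next
  case (add f g)
  then show ?case by (simp only: distrib_right trig_polys.add)
qed

lemma trig_polys_power:
  assumes "f \<in> trig_polys d"
  shows "(\<lambda>x. f x ^ n) \<in> trig_polys d"
  by (induction n) (auto intro: trig_polys_const trig_polys_mult assms)

lemma trig_polys_sum:
  assumes "finite I" "\<And>i. i \<in> I \<Longrightarrow> f i \<in> trig_polys d"
  shows "(\<lambda>x. \<Sum>i\<in>I. f i x) \<in> trig_polys d"
  using assms
  by (induction I rule: finite_induct) (auto intro: trig_polys_const trig_polys.add)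

lemma trig_polys_cos_shift:
  assumes "j \<in> {1..d}"
  shows "(\<lambda>x. of_real (cos (2 * pi * (x j - a)))) \<in> trig_polys d"
proof -
  have s: "(\<Sum>i=1..d. of_int (if i = j then n else 0) * x i) = of_int n * x j" for n :: int and x :: "nat \<Rightarrow> real"
  proof -
    have "(\<Sum>i=1..d. of_int (if i = j then n else 0) * x i) = (\<Sum>i=1..d. if i = j then of_int n * x i else 0)"
      by (intro sum.cong) auto
    then show ?thesis using assms by simp
  qed
  have "of_real (cos (2 * pi * (x j - a))) =
     (cis (- 2 * pi * a) / 2) * chi d (\<lambda>i. if i = j then 1 else 0) x
     + (cis (2 * pi * a) / 2) * chi d (\<lambda>i. if i = j then -1 else 0) x" for x
    unfolding chi_def s by (simp add: complex_eq_iff cis_mult cos_add sin_add cos_diff sin_diff right_diff_distrib)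
      (simp add: field_simps)
  then show ?thesis by (simp only: trig_polys.intros)
qed

lemma integral_mult_trig_poly_eq_0:
  assumes "integrable (cube_measure d) h"
    and "\<And>k. (\<integral>x. h x * chi d k x \<partial>cube_measure d) = 0"
    and "f \<in> trig_polys d"
  shows "integrable (cube_measure d) (\<lambda>x. h x * f x) \<and> (\<integral>x. h x * f x \<partial>cube_measure d) = 0"
  using assms(3)
proof induction
  case (monomial c k)
  have "(\<lambda>x. h x * (c * chi d k x)) = (\<lambda>x. c * (h x * chi d k x))" by (simp add: mult_ac)
  then show ?case using integrable_mult_chi[OF assms(1)] assms(2) by simp
next
  case (add f g)
  then show ?case by (simp add: distrib_left)
qed

section \<open>Uniqueness of Fourier coefficients\<close>

text \<open>Continuity is meant for the product topology on functions from all natural numbers. Points of the cube agree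
  outside \<open>{1..d}\<close>, so only finitely many coordinates matter, and a uniform radius exists.\<close>

lemma cube_neighbourhood:
  assumes "continuous_on (cube d) u" "x \<in> cube d" "c < (u x :: real)"
  obtains \<eta> where "\<eta> > 0" "\<And>y. y \<in> cube d \<Longrightarrow> (\<And>j. j \<in> {1..d} \<Longrightarrow> \<bar>y j - x j\<bar> < \<eta>) \<Longrightarrow> c < u y"
proof -
  obtain A where A: "open A" "x \<in> A" "\<And>y. y \<in> cube d \<Longrightarrow> y \<in> A \<Longrightarrow> u y \<in> {c<..}"
    using assms(1)[unfolded continuous_on_topological, rule_format, of x "{c<..}"] assms(2,3) by auto
  have "openin (product_topology (\<lambda>_. euclidean) UNIV) A"
    using A(1) by (simp only: euclidean_product_topology open_openin)
  from product_topology_open_contains_basis[OF this A(2)]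
  obtain X where X: "x \<in> (\<Pi>\<^sub>E i\<in>UNIV. X i)" "\<And>i. open (X i)" "(\<Pi>\<^sub>E i\<in>UNIV. X i) \<subseteq> A"
    by auto
  have "\<exists>e>0. \<forall>t. dist t (x j) < e \<longrightarrow> t \<in> X j" for j
    using X(1,2) open_dist[of "X j"] by auto
  then obtain e where e: "\<And>j. e j > 0" "\<And>j t. dist t (x j) < e j \<Longrightarrow> t \<in> X j" by metis
  define \<eta> where "\<eta> = Min (insert 1 (e ` {1..d}))"
  have \<eta>: "\<eta> \<le> e j" if "j \<in> {1..d}" for j unfolding \<eta>_def using that by (intro Min_le) auto
  show ?thesis
  proof
    show "\<eta> > 0" using e(1) by (simp add: \<eta>_def)
  next
    fix y assume y: "y \<in> cube d" "\<And>j. j \<in> {1..d} \<Longrightarrow> \<bar>y j - x j\<bar> < \<eta>"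
    have "y i \<in> X i" for i
    proof (cases "i \<in> {1..d}")
      case True
      then show ?thesis using y(2)[OF True] \<eta>[OF True] by (intro e(2)) (simp add: dist_real_def)
    next
      case False
      then have "y i = x i" using y(1) assms(2) by (auto simp: cube_def PiE_def extensional_def)
      then show ?thesis using X(1) by auto
    qed
    then have "y \<in> A" using X(3) by auto
    with A(3) y(1) show "c < u y" by auto
  qed
qed

lemma measure_cube_box:
  fixes x :: "nat \<Rightarrow> real"
  assumes "\<And>j. j \<in> {1..d} \<Longrightarrow> \<eta> \<le> x j \<and> x j \<le> 1 - \<eta>" "\<eta> > 0"
  shows "(\<Pi>\<^sub>E j\<in>{1..d}. {x j - \<eta><..<x j + \<eta>}) \<in> sets (cube_measure d)"
    and "measure (cube_measure d) (\<Pi>\<^sub>E j\<in>{1..d}. {x j - \<eta><..<x j + \<eta>}) > 0"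
    and "(\<Pi>\<^sub>E j\<in>{1..d}. {x j - \<eta><..<x j + \<eta>}) \<subseteq> cube d"
proof -
  let ?B = "\<Pi>\<^sub>E j\<in>{1..d}. {x j - \<eta><..<x j + \<eta>}"
  have sub: "{x j - \<eta><..<x j + \<eta>} \<subseteq> {0..<1}" if "j \<in> {1..d}" for j
    using assms(1)[OF that] by auto
  show "?B \<subseteq> cube d" unfolding cube_def using sub by (rule PiE_mono)
  have sets: "{x j - \<eta><..<x j + \<eta>} \<in> sets unit_measure" if "j \<in> {1..d}" for j
    using sub[OF that] by (simp add: sets_restrict_space_iff)
  then show "?B \<in> sets (cube_measure d)"
    unfolding cube_measure_def by (intro sets_PiM_I_finite) auto
  have "emeasure (cube_measure d) ?B = (\<Prod>j\<in>{1..d}. emeasure unit_measure {x j - \<eta><..<x j + \<eta>})"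
    unfolding cube_measure_def using sets by (intro unit_product.emeasure_PiM) auto
  also have "\<dots> = (\<Prod>j\<in>{1..d}. ennreal (2 * \<eta>))"
    using sub assms(2) by (intro prod.cong refl) (auto simp: emeasure_restrict_space)
  also have "\<dots> = ennreal ((2 * \<eta>) ^ d)"
    using assms(2) by (simp add: ennreal_power)
  finally show "measure (cube_measure d) ?B > 0"
    using assms(2) by (simp add: measure_def)
qed

text \<open>Differences of points of the cube range over $(-1,1)$ and not over one period, so being far from \<open>0\<close> on the
  circle requires staying away from \<open>1\<close> and \<open>-1\<close> as well.\<close>

lemma cos_le_cos_away:
  fixes \<eta> t :: real
  assumes "0 < \<eta>" "\<eta> \<le> \<bar>t\<bar>" "\<bar>t\<bar> \<le> 1 - \<eta>"
  shows "cos (2 * pi * t) \<le> cos (2 * pi * \<eta>)"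
proof -
  have abs: "cos (2 * pi * t) = cos (2 * pi * \<bar>t\<bar>)" by (auto simp: abs_if)
  have le: "cos (2 * pi * s) \<le> cos (2 * pi * \<eta>)" if "\<eta> \<le> s" "s \<le> 1/2" for s
    using that assms(1) by (intro cos_monotone_0_pi_le) auto
  show ?thesis
  proof (cases "\<bar>t\<bar> \<le> 1/2")
    case True
    then show ?thesis using le[of "\<bar>t\<bar>"] assms abs by simp
  next
    case False
    have "cos (2 * pi * \<bar>t\<bar>) = cos (2 * pi * (1 - \<bar>t\<bar>))"
      by (simp add: right_diff_distrib cos_diff)
    then show ?thesis using le[of "1 - \<bar>t\<bar>"] assms abs False by simp
  qed
qed

text \<open>Powers of the trigonometric polynomial $A(y) = \sum_j (1 + \cos 2\pi(y_j - x_j))$ concentrate at \<open>x\<close>.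
  Scaled by \<open>s\<close>, it is at least 1 on a small box \<open>V\<close> around \<open>x\<close> and at most some \<open>q < 1\<close> outside a larger box on
  which \<open>u\<close> is still positive. For a large exponent the contribution of \<open>V\<close> therefore dominates, even
  though \<open>u\<close> is merely integrable away from \<open>x\<close>. The coordinates of \<open>x\<close> have to be positive because a neighbourhood of
  \<open>x\<close> on the torus must lie inside the cube: \<open>u\<close> need not be continuous across the faces.\<close>

lemma peaked_kernel_detects_positivity:
  fixes u :: "(nat \<Rightarrow> real) \<Rightarrow> real"
  assumes int_u: "integrable (cube_measure d) u" and cont: "continuous_on (cube d) u"
    and x: "x \<in> cube d" "\<And>j. j \<in> {1..d} \<Longrightarrow> x j > 0" and pos: "u x > 0" and d: "d \<ge> 1"
  obtains s :: real and N :: nat where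
    "(\<integral>y. u y * (s * (\<Sum>j=1..d. 1 + cos (2 * pi * (y j - x j)))) ^ N \<partial>cube_measure d) > 0"
proof -
  let ?M = "cube_measure d"
  interpret prob_space ?M by (rule prob_space_cube_measure)
  define A where "A y = (\<Sum>j=1..d. 1 + cos (2 * pi * (y j - x j)))" for y
  define c where "c = u x / 2"
  have c: "c > 0" "c < u x" using pos by (auto simp: c_def)
  obtain \<eta>0 where \<eta>0: "\<eta>0 > 0"
    "\<And>y. y \<in> cube d \<Longrightarrow> (\<And>j. j \<in> {1..d} \<Longrightarrow> \<bar>y j - x j\<bar> < \<eta>0) \<Longrightarrow> c < u y"
    using cube_neighbourhood[OF cont x(1) c(2)] by blast
  have x01: "0 < x j \<and> x j < 1" if "j \<in> {1..d}" for j
    using x(1) x(2)[OF that] that by (auto simp: cube_def)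
  define \<eta> where "\<eta> = Min (insert \<eta>0 ((\<lambda>j. min (x j) (1 - x j)) ` {1..d}))"
  have \<eta>pos: "\<eta> > 0" using \<eta>0(1) x01 by (simp add: \<eta>_def)
  have \<eta>le0: "\<eta> \<le> \<eta>0" by (simp add: \<eta>_def)
  have \<eta>x: "\<eta> \<le> x j \<and> x j \<le> 1 - \<eta>" if "j \<in> {1..d}" for j
  proof -
    have "\<eta> \<le> min (x j) (1 - x j)" unfolding \<eta>_def using that by (intro Min_le) auto
    then show ?thesis by auto
  qed
  have \<eta>half: "\<eta> \<le> 1/2" using \<eta>x[of 1] d by simp
  \<comment> \<open>\<open>\<kappa>\<close> is the loss in \<open>A\<close> when a single coordinate is at distance \<open>\<eta>\<close> or more; the inner box is chosen to
    lose at most half of it in total, and \<open>s\<close> normalises at that level\<close>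
  define \<kappa> where "\<kappa> = 1 - cos (2 * pi * \<eta>)"
  have "cos (2 * pi * \<eta>) < cos 0" using \<eta>pos \<eta>half by (intro cos_monotone_0_pi) auto
  then have \<kappa>: "\<kappa> > 0" "\<kappa> \<le> 2" using cos_ge_minus_one[of "2 * pi * \<eta>"] by (auto simp: \<kappa>_def)
  have e0: "\<kappa> / (2 * real d) > 0" using \<kappa> d by simp
  have isC: "isCont (\<lambda>t::real. cos (2 * pi * t)) 0" by (intro continuous_intros)
  obtain \<delta> where "\<delta> > 0"
    "\<forall>t. \<bar>t - 0\<bar> < \<delta> \<longrightarrow> \<bar>cos (2 * pi * t) - cos (2 * pi * 0)\<bar> < \<kappa> / (2 * real d)"
    using isC[unfolded continuous_at_real_range, THEN spec, THEN mp, OF e0]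
    unfolding real_norm_def by (elim exE conjE) (rule that)
  then have \<delta>: "\<delta> > 0" "\<And>t. \<bar>t\<bar> < \<delta> \<Longrightarrow> \<bar>cos (2 * pi * t) - 1\<bar> < \<kappa> / (2 * real d)"
    by auto
  define \<eta>' where "\<eta>' = min \<delta> \<eta>"
  have \<eta>': "\<eta>' > 0" "\<eta>' \<le> \<delta>" "\<eta>' \<le> \<eta>" using \<delta> \<eta>pos by (auto simp: \<eta>'_def)
  define V where "V = (\<Pi>\<^sub>E j\<in>{1..d}. {x j - \<eta>'<..<x j + \<eta>'})"
  have "\<eta>' \<le> x j \<and> x j \<le> 1 - \<eta>'" if "j \<in> {1..d}" for j using \<eta>x[OF that] \<eta>'(3) by auto
  from measure_cube_box[OF this \<eta>'(1)]
  have V: "V \<in> sets ?M" "measure ?M V > 0" "V \<subseteq> cube d" unfolding V_def by auto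
  have V_abs: "\<bar>y j - x j\<bar> < \<eta>'" if "y \<in> V" "j \<in> {1..d}" for y j
  proof -
    have "y j \<in> {x j - \<eta>'<..<x j + \<eta>'}" using that unfolding V_def by (rule PiE_mem)
    then show ?thesis by (auto simp: abs_less_iff)
  qed
  define s where "s = 1 / (2 * real d - \<kappa> / 2)"
  have den: "2 * real d - \<kappa> / 2 > 0" using \<kappa> d by simp
  then have s: "s > 0" by (simp add: s_def)
  define q where "q = s * (2 * real d - \<kappa>)"
  have "2 * real d \<ge> 2" using d by simp
  then have "2 * real d - \<kappa> \<ge> 0" using \<kappa> by linarith
  then have q: "0 \<le> q" "q < 1"
    using \<kappa> den s by (simp_all add: q_def) (simp add: s_def divide_less_eq)
  have A0: "A y \<ge> 0" for y
    unfolding A_def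
  proof (intro sum_nonneg)
    show "0 \<le> 1 + cos (2 * pi * (y j - x j))" for j
      using cos_ge_minus_one[of "2 * pi * (y j - x j)"] by linarith
  qed
  have A_le: "A y \<le> 2 * real d" for y
  proof -
    have "A y \<le> (\<Sum>j=1..d. 2)" unfolding A_def by (intro sum_mono) simp
    then show ?thesis by simp
  qed
  have inV: "1 \<le> s * A y" if "y \<in> V" for y
  proof -
    have "2 - \<kappa> / (2 * real d) \<le> 1 + cos (2 * pi * (y j - x j))" if j: "j \<in> {1..d}" for j
    proof -
      have "\<bar>y j - x j\<bar> < \<delta>" using V_abs[OF \<open>y \<in> V\<close> j] \<eta>'(2) by linarith
      from \<delta>(2)[OF this] show ?thesis by (auto simp: abs_less_iff)
    qed
    then have "(\<Sum>j=1..d. 2 - \<kappa> / (2 * real d)) \<le> A y" unfolding A_def by (intro sum_mono) auto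
    also have "(\<Sum>j=1..d. 2 - \<kappa> / (2 * real d)) = 2 * real d - \<kappa> / 2" using d by (simp add: field_simps)
    finally show ?thesis using den by (simp add: s_def)
  qed
  have outU: "s * A y \<le> q" if "y \<in> cube d" "i \<in> {1..d}" "\<bar>y i - x i\<bar> \<ge> \<eta>" for y i
  proof -
    have "y i \<in> {0..<1}" using that by (auto simp: cube_def)
    then have "\<bar>y i - x i\<bar> \<le> 1 - \<eta>" using \<eta>x[OF that(2)] by auto
    then have ci: "cos (2 * pi * (y i - x i)) \<le> 1 - \<kappa>"
      using cos_le_cos_away[OF \<eta>pos that(3)] by (simp add: \<kappa>_def)
    have "A y = (1 + cos (2 * pi * (y i - x i))) + (\<Sum>j\<in>{1..d} - {i}. 1 + cos (2 * pi * (y j - x j)))"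
      unfolding A_def using that(2) by (intro sum.remove) auto
    also have "(\<Sum>j\<in>{1..d} - {i}. 1 + cos (2 * pi * (y j - x j))) \<le> (\<Sum>j\<in>{1..d} - {i}. 2)"
      by (intro sum_mono) simp
    also have "(\<Sum>j\<in>{1..d} - {i}. 2) = 2 * (real d - 1)" using that(2) d by (simp add: of_nat_diff)
    finally have "A y \<le> 2 * real d - \<kappa>" using ci by simp
    then show ?thesis using s by (simp add: q_def)
  qed
  define I where "I = (\<integral>y. \<bar>u y\<bar> \<partial>?M)"
  have I: "I \<ge> 0" by (simp add: I_def)
  obtain N where N: "q ^ N < c * measure ?M V / (1 + I)"
    using real_arch_pow_inv[of "c * measure ?M V / (1 + I)" q] q c V I by auto
  have measA: "A \<in> borel_measurable ?M"
    unfolding A_def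
  proof (intro borel_measurable_sum)
    fix j assume j: "j \<in> {1..d}"
    have "(\<lambda>t. 1 + cos (2 * pi * (t - x j))) \<in> borel_measurable borel"
      by (intro borel_measurable_continuous_onI continuous_intros)
    then show "(\<lambda>y. 1 + cos (2 * pi * (y j - x j))) \<in> borel_measurable ?M"
      by (rule measurable_compose[OF measurable_cube_coordinate[OF j]])
  qed
  have measu: "u \<in> borel_measurable ?M" using int_u by auto
  have int: "integrable ?M (\<lambda>y. u y * (s * A y) ^ N)"
  proof (rule Bochner_Integration.integrable_bound)
    show "integrable ?M (\<lambda>y. (s * (2 * real d)) ^ N * u y)" using int_u by simp
    show "(\<lambda>y. u y * (s * A y) ^ N) \<in> borel_measurable ?M" using measA measu by measurable
    have "\<bar>u y * (s * A y) ^ N\<bar> \<le> \<bar>(s * (2 * real d)) ^ N * u y\<bar>" for y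
    proof -
      have "(s * A y) ^ N \<le> (s * (2 * real d)) ^ N" using s A0 A_le by (intro power_mono mult_left_mono) auto
      then have "\<bar>u y\<bar> * (s * A y) ^ N \<le> \<bar>u y\<bar> * (s * (2 * real d)) ^ N" by (intro mult_left_mono) auto
      then show ?thesis using s A0[of y] by (simp add: abs_mult mult.commute power_abs)
    qed
    then show "AE y in ?M. norm (u y * (s * A y) ^ N) \<le> norm ((s * (2 * real d)) ^ N * u y)" by simp
  qed
  have int_V: "integrable ?M (indicator V :: _ \<Rightarrow> real)"
    using V by (intro integrable_real_indicator) (auto simp: emeasure_eq_measure)
  have "c * measure ?M V - q ^ N * I > 0"
  proof -
    have "q ^ N * I \<le> q ^ N * (1 + I)" using q I by (intro mult_left_mono) auto
    also have "\<dots> < c * measure ?M V" using N I by (simp add: pos_less_divide_eq)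
    finally show ?thesis by simp
  qed
  also have "c * measure ?M V - q ^ N * I = (\<integral>y. c * indicator V y - q ^ N * \<bar>u y\<bar> \<partial>?M)"
    using V int_V int_u by (simp add: I_def Bochner_Integration.integral_diff Int_absorb2)
  also have "\<dots> \<le> (\<integral>y. u y * (s * A y) ^ N \<partial>?M)"
  proof (rule integral_mono[OF _ int])
    show "integrable ?M (\<lambda>y. c * indicator V y - q ^ N * \<bar>u y\<bar>)" using int_V int_u by simp
  next
    fix y assume "y \<in> space ?M"
    then have y: "y \<in> cube d" by simp
    have sA: "0 \<le> (s * A y) ^ N" using s A0 by simp
    show "c * indicator V y - q ^ N * \<bar>u y\<bar> \<le> u y * (s * A y) ^ N"
    proof (cases "\<forall>j\<in>{1..d}. \<bar>y j - x j\<bar> < \<eta>")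
      case True
      then have uy: "c < u y" using \<eta>0(2)[OF y] \<eta>le0 by fastforce
      have "c * indicator V y \<le> u y * (s * A y) ^ N"
      proof (cases "y \<in> V")
        case True
        then have "1 \<le> (s * A y) ^ N" using inV one_le_power by blast
        then have "c * 1 \<le> u y * (s * A y) ^ N" using uy c by (intro mult_mono) auto
        then show ?thesis using True by simp
      next
        case False
        then show ?thesis using uy c sA by simp
      qed
      moreover have "0 \<le> q ^ N * \<bar>u y\<bar>" using q by simp
      ultimately show ?thesis by linarith
    next
      case False
      then obtain i where i: "i \<in> {1..d}" "\<bar>y i - x i\<bar> \<ge> \<eta>" by force
      have "y \<notin> V" using V_abs[of y i] i \<eta>'(3) by auto
      moreover have "(s * A y) ^ N \<le> q ^ N" using outU[OF y i] s A0 by (intro power_mono) auto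
      then have "\<bar>u y\<bar> * (s * A y) ^ N \<le> \<bar>u y\<bar> * q ^ N" by (intro mult_left_mono) auto
      moreover have "- (\<bar>u y\<bar> * (s * A y) ^ N) \<le> u y * (s * A y) ^ N"
        using mult_right_mono[OF _ sA, of "- \<bar>u y\<bar>" "u y"] by simp
      ultimately show ?thesis by (simp add: mult.commute)
    qed
  qed
  finally show ?thesis by (intro that[of s N]) (simp add: A_def)
qed

text \<open>Multiplying \<open>h\<close> by the conjugate of its value at \<open>x\<close> makes the real part positive there, and
  the peaked kernel, being a trigonometric polynomial, is orthogonal to \<open>h\<close>.\<close>

lemma fourier_uniqueness_interior:
  fixes h :: "(nat \<Rightarrow> real) \<Rightarrow> complex"
  assumes "d \<ge> 1" "integrable (cube_measure d) h" "continuous_on (cube d) h"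
    and zero: "\<And>k. (\<integral>x. h x * chi d k x \<partial>cube_measure d) = 0"
    and x: "x \<in> cube d" "\<And>j. j \<in> {1..d} \<Longrightarrow> x j > 0"
  shows "h x = 0"
proof (rule ccontr)
  assume hx: "h x \<noteq> 0"
  define u where "u y = Re (cnj (h x) * h y)" for y
  have "cnj (h x) * h x = complex_of_real ((norm (h x))\<^sup>2)"
    by (metis complex_norm_square mult.commute of_real_power)
  then have "u x = (norm (h x))\<^sup>2" unfolding u_def by (simp only: Re_complex_of_real)
  then have pos: "u x > 0" using hx by simp
  have int: "integrable (cube_measure d) u"
    unfolding u_def using assms(2) by (intro integrable_Re integrable_mult_right)
  have cont: "continuous_on (cube d) u"
    unfolding u_def using assms(3) by (intro continuous_intros)
  obtain s N where sN:
    "(\<integral>y. u y * (s * (\<Sum>j=1..d. 1 + cos (2 * pi * (y j - x j)))) ^ N \<partial>cube_measure d) > 0"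
    using peaked_kernel_detects_positivity[OF int cont x pos assms(1)] by blast
  define T :: "(nat \<Rightarrow> real) \<Rightarrow> complex"
    where "T y = (of_real s * (\<Sum>j=1..d. 1 + of_real (cos (2 * pi * (y j - x j))))) ^ N" for y
  have "T \<in> trig_polys d"
    unfolding T_def
    by (intro trig_polys_power trig_polys_mult trig_polys_const trig_polys_sum trig_polys.add
        trig_polys_cos_shift) auto
  from integral_mult_trig_poly_eq_0[OF assms(2) zero this]
  have T: "integrable (cube_measure d) (\<lambda>y. h y * T y)" "(\<integral>y. h y * T y \<partial>cube_measure d) = 0" by auto
  have "T y = of_real ((s * (\<Sum>j=1..d. 1 + cos (2 * pi * (y j - x j)))) ^ N)" for y
    by (simp add: T_def)
  then have "u y * (s * (\<Sum>j=1..d. 1 + cos (2 * pi * (y j - x j)))) ^ N = Re (cnj (h x) * (h y * T y))" for y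
    unfolding u_def by (simp only: mult.assoc[symmetric] times_complex.sel(1)[of _ "of_real _"]
        Re_complex_of_real Im_complex_of_real mult_zero_right diff_zero)
  then have "(\<integral>y. u y * (s * (\<Sum>j=1..d. 1 + cos (2 * pi * (y j - x j)))) ^ N \<partial>cube_measure d)
     = (\<integral>y. Re (cnj (h x) * (h y * T y)) \<partial>cube_measure d)" by simp
  also have "\<dots> = Re (\<integral>y. cnj (h x) * (h y * T y) \<partial>cube_measure d)"
    using T(1) by (intro integral_Re integrable_mult_right)
  also have "\<dots> = 0" using T by simp
  finally show False using sN by simp
qed

text \<open>A point on a face of the cube is the end point of a segment whose other points have positive coordinates, so
  the interior case extends by continuity.\<close>

lemma fourier_uniqueness:
  fixes h :: "(nat \<Rightarrow> real) \<Rightarrow> complex"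
  assumes "d \<ge> 1" "integrable (cube_measure d) h" "continuous_on (cube d) h"
    and zero: "\<And>k. (\<integral>x. h x * chi d k x \<partial>cube_measure d) = 0"
    and x: "x \<in> cube d"
  shows "h x = 0"
proof -
  define \<gamma> where "\<gamma> t = (\<lambda>j. if j \<in> {1..d} \<and> x j = 0 then t else x j)" for t :: real
  have \<gamma>: "\<gamma> t \<in> cube d" if "t \<in> {0..<1}" for t
    using x that by (auto simp: \<gamma>_def cube_def PiE_def Pi_def extensional_def)
  have "h (\<gamma> t) = 0" if "t \<in> {0<..<1/2}" for t
  proof (rule fourier_uniqueness_interior[OF assms(1-3) zero])
    show "\<gamma> t \<in> cube d" using \<gamma> that by simp
    show "\<gamma> t j > 0" if "j \<in> {1..d}" for j
      using x \<open>t \<in> _\<close> that by (auto simp: \<gamma>_def cube_def PiE_def Pi_def less_le)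
  qed
  moreover have "continuous_on {0..1/2} (\<lambda>t. h (\<gamma> t))"
  proof (rule continuous_on_compose2[OF assms(3)])
    show "continuous_on {0..1/2} \<gamma>"
    proof (rule continuous_on_coordinatewise_then_product)
      show "continuous_on {0..1/2} (\<lambda>t. \<gamma> t i)" for i
      proof (cases "i \<in> {1..d} \<and> x i = 0")
        case True
        then have "(\<lambda>t. \<gamma> t i) = (\<lambda>t. t)" by (auto simp: \<gamma>_def)
        then show ?thesis by (simp only: continuous_on_id)
      next
        case False
        then have "(\<lambda>t. \<gamma> t i) = (\<lambda>t. x i)" by (auto simp: \<gamma>_def)
        then show ?thesis by (simp only: continuous_on_const)
      qed
    qed
    show "\<gamma> ` {0..1/2} \<subseteq> cube d" using \<gamma> by auto
  qed
  moreover have cl: "closure {0<..<1/2::real} = {0..1/2}" by simp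
  moreover have "(0::real) \<in> {0..1/2}" by simp
  ultimately have "h (\<gamma> 0) = 0"
    using continuous_constant_on_closure[of "{0<..<1/2::real}" "\<lambda>t. h (\<gamma> t)" 0 0]
    by (simp only: cl)
  moreover have "\<gamma> 0 = x" by (auto simp: \<gamma>_def)
  ultimately show ?thesis by simp
qed

section \<open>Fourier inversion and the cubature error\<close>

text \<open>The Fourier coefficient pairs with the conjugate character, and it is indexed by extensional
  frequencies; hence the negated and restricted index.\<close>

lemma integral_mult_chi_eq_fourier_coeff:
  "(\<integral>x. of_real (f x) * chi d k x \<partial>cube_measure d) =
     fourier_coeff d f (\<lambda>j\<in>{1..d}. - k j)"
proof -
  have "exp (- 2 * complex_of_real pi * \<i> * complex_of_real (\<Sum>j=1..d. of_int ((\<lambda>j\<in>{1..d}. - k j) j) * x j))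
      = chi d k x" for x
  proof -
    have "(\<Sum>j=1..d. of_int ((\<lambda>j\<in>{1..d}. - k j) j) * x j) = - (\<Sum>j=1..d. of_int (k j) * x j)"
      by (simp add: sum_negf)
    then show ?thesis unfolding chi_def cis_conv_exp
      by (simp only: of_real_minus of_real_mult of_real_numeral) (simp add: mult_ac)
  qed
  then show ?thesis unfolding fourier_coeff_def by simp
qed

lemma width_ge_1: "width u \<ge> 1"
  by (simp add: width_def)

lemma width_le_weight: "real (width (supp d k)) \<le> weight d k"
  by (simp add: weight_def)

lemma weight_ge_1: "weight d k \<ge> 1"
  using width_le_weight[of d k] width_ge_1[of "supp d k"] by linarith

text \<open>The weight is at least 1, so the Fourier coefficients are absolutely summable and the Fourier series converges uniformly
  to a continuous function \<open>g\<close> with the same Fourier coefficients as \<open>f\<close>. By uniqueness, \<open>f\<close> and \<open>g\<close> agree on the cube.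
  Partial sums run over finite sets of frequencies; all that is used is that some of them, containing
  any prescribed frequencies, are uniformly close to \<open>g\<close>.\<close>

lemma fourier_inversion:
  assumes d: "d \<ge> 1" and f: "f \<in> F2 d" and x: "x \<in> cube d"
  shows "((\<lambda>k. fourier_coeff d f k * chi d k x) has_sum of_real (f x)) (freqs d)"
proof -
  let ?M = "cube_measure d" and ?K = "freqs d"
  interpret prob_space ?M by (rule prob_space_cube_measure)
  define c where "c = fourier_coeff d f"
  have "(\<lambda>k. cmod (c k) * weight d k) summable_on ?K" using f by (simp add: F2_def c_def)
  then have summ: "(\<lambda>k. cmod (c k)) summable_on ?K"
  proof (rule summable_on_comparison_test)
    show "cmod (c k) \<le> cmod (c k) * weight d k" for k
      using mult_left_mono[OF weight_ge_1[of d k], of "cmod (c k)"] by simp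
  qed simp
  define S where "S F y = (\<Sum>k\<in>F. c k * chi d k y)" for F y
  define g where "g y = (\<Sum>\<^sub>\<infinity>k\<in>?K. c k * chi d k y)" for y
  have unif: "uniform_limit UNIV S g (finite_subsets_at_top ?K)"
    unfolding S_def g_def
    by (rule Weierstrass_m_test_general[where M = "\<lambda>k. cmod (c k)"]) (auto simp: norm_mult summ)
  have approx: "\<exists>F. finite F \<and> F \<subseteq> ?K \<and> F0 \<subseteq> F \<and> (\<forall>y. dist (S F y) (g y) < e)"
    if "e > 0" "finite F0" "F0 \<subseteq> ?K" for e F0
  proof -
    have "\<forall>\<^sub>F F in finite_subsets_at_top ?K. finite F \<and> F0 \<subseteq> F \<and> F \<subseteq> ?K"
      unfolding eventually_finite_subsets_at_top using that by blast
    with uniform_limitD[OF unif that(1)]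
    have "\<forall>\<^sub>F F in finite_subsets_at_top ?K. finite F \<and> F \<subseteq> ?K \<and> F0 \<subseteq> F \<and> (\<forall>y. dist (S F y) (g y) < e)"
      by eventually_elim auto
    then show ?thesis by (rule eventually_happens'[OF finite_subsets_at_top_neq_bot])
  qed
  have int_S: "integrable ?M (S F)" for F
    unfolding S_def by (intro Bochner_Integration.integrable_sum integrable_mult_right integrable_chi)
  have cont_g: "continuous_on UNIV g"
  proof (rule uniform_limit_theorem[OF _ unif])
    show "\<forall>\<^sub>F F in finite_subsets_at_top ?K. continuous_on UNIV (S F)"
      unfolding S_def by (intro always_eventually allI continuous_intros continuous_on_chi)
  qed simp
  \<comment> \<open>The sigma-algebra of the product measure is not the Borel algebra on all functions, so measurability
    comes from a sequence of partial sums and not from continuity.\<close>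
  have meas_g: "g \<in> borel_measurable ?M"
  proof -
    have "\<exists>F. \<forall>y. dist (S F y) (g y) < inverse (real (Suc n))" for n
      using approx[of "inverse (real (Suc n))" "{}"] by auto
    then obtain F where F: "\<And>n y. dist (S (F n) y) (g y) < inverse (real (Suc n))" by metis
    show ?thesis
    proof (rule borel_measurable_LIMSEQ_metric)
      show "S (F n) \<in> borel_measurable ?M" for n using int_S by auto
      show "(\<lambda>n. S (F n) y) \<longlonglongrightarrow> g y" for y
        by (rule metric_tendsto_imp_tendsto[OF LIMSEQ_inverse_real_of_nat])
          (use F in \<open>auto intro!: always_eventually less_imp_le simp: dist_real_def simp del: of_nat_Suc\<close>)
    qed
  qed
  obtain F1 where F1: "\<And>y. dist (S F1 y) (g y) < 1" using approx[of 1 "{}"] by auto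
  have int_g: "integrable ?M g"
  proof (rule Bochner_Integration.integrable_bound)
    show "integrable ?M (\<lambda>y. norm (S F1 y) + 1)" using int_S by auto
    have "norm (g y) \<le> norm (S F1 y) + 1" for y
      using F1[of y] norm_triangle_ineq2[of "g y" "S F1 y"] by (simp add: dist_norm norm_minus_commute)
    then show "AE y in ?M. norm (g y) \<le> norm (norm (S F1 y) + 1)" by simp
  qed (rule meas_g)
  have coeff_g: "(\<integral>y. g y * chi d k y \<partial>?M) = c (\<lambda>j\<in>{1..d}. - k j)" for k
  proof -
    define l where "l = (\<lambda>j\<in>{1..d}. - k j)"
    have l: "l \<in> ?K" by (auto simp: l_def freqs_def)
    have orth: "(\<integral>y. chi d k' y * chi d k y \<partial>?M) = (if k' = l then 1 else 0)" if "k' \<in> ?K" for k'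
    proof -
      have "(\<forall>j\<in>{1..d}. k' j + k j = 0) \<longleftrightarrow> k' = l"
      proof
        assume *: "\<forall>j\<in>{1..d}. k' j + k j = 0"
        show "k' = l"
        proof
          show "k' j = l j" for j
            using * that by (cases "j \<in> {1..d}") (auto simp: l_def freqs_def PiE_def extensional_def eq_neg_iff_add_eq_0)
        qed
      qed (auto simp: l_def)
      then show ?thesis by (simp add: chi_mult integral_chi)
    qed
    have "norm ((\<integral>y. g y * chi d k y \<partial>?M) - c l) \<le> e" if e: "e > 0" for e
    proof -
      obtain F where F: "finite F" "F \<subseteq> ?K" "l \<in> F" "\<And>y. dist (S F y) (g y) < e"
        using approx[OF e, of "{l}"] l by auto
      have "(\<integral>y. S F y * chi d k y \<partial>?M) = (\<Sum>k'\<in>F. c k' * (\<integral>y. chi d k' y * chi d k y \<partial>?M))"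
        unfolding S_def sum_distrib_right mult.assoc
        by (subst Bochner_Integration.integral_sum) (auto intro!: integrable_mult_right integrable_mult_chi integrable_chi)
      also have "\<dots> = (\<Sum>k'\<in>F. c k' * (if k' = l then 1 else 0))"
        using F(2) orth by (intro sum.cong) auto
      also have "\<dots> = (\<Sum>k'\<in>F. if k' = l then c k' else 0)" by (intro sum.cong) auto
      also have "\<dots> = c l" using F by simp
      finally have "(\<integral>y. g y * chi d k y \<partial>?M) - c l = (\<integral>y. (g y - S F y) * chi d k y \<partial>?M)"
        using integrable_mult_chi[OF int_g] integrable_mult_chi[OF int_S[of F]]
        by (simp add: left_diff_distrib)
      also have "norm \<dots> \<le> (\<integral>y. norm ((g y - S F y) * chi d k y) \<partial>?M)"
        by (rule integral_norm_bound)
      also have "\<dots> \<le> (\<integral>y. e \<partial>?M)"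
      proof (rule integral_mono)
        show "integrable ?M (\<lambda>y. norm ((g y - S F y) * chi d k y))"
          using int_g int_S by (intro integrable_norm integrable_mult_chi Bochner_Integration.integrable_diff)
        show "norm ((g y - S F y) * chi d k y) \<le> e" for y
          using F(4)[of y] by (simp add: norm_mult dist_norm norm_minus_commute)
      qed simp
      also have "\<dots> = e" using prob_space by simp
      finally show ?thesis .
    qed
    then have "norm ((\<integral>y. g y * chi d k y \<partial>?M) - c l) \<le> 0" by (rule field_le_epsilon[where y=0, simplified])
    then show ?thesis by (simp add: l_def)
  qed
  have int_f: "integrable ?M (\<lambda>y. complex_of_real (f y))" using f by (simp add: F2_def)
  have "of_real (f x) - g x = 0"
  proof (rule fourier_uniqueness[OF d _ _ _ x])
    show "integrable ?M (\<lambda>y. of_real (f y) - g y)" using int_f int_g by simp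
    show "continuous_on (cube d) (\<lambda>y. of_real (f y) - g y)"
      using f continuous_on_subset[OF cont_g] by (auto simp: F2_def intro!: continuous_intros)
    show "(\<integral>y. (of_real (f y) - g y) * chi d k y \<partial>?M) = 0" for k
      using integrable_mult_chi[OF int_f] integrable_mult_chi[OF int_g]
      by (simp add: left_diff_distrib coeff_g integral_mult_chi_eq_fourier_coeff c_def)
  qed
  moreover have "(\<lambda>k. c k * chi d k x) summable_on ?K"
    by (rule abs_summable_summable) (simp add: norm_mult summ)
  then have "((\<lambda>k. c k * chi d k x) has_sum g x) ?K" unfolding g_def by (rule has_sum_infsum)
  ultimately show ?thesis by (simp add: c_def)
qed

lemma has_sum_sum:
  fixes f :: "'i \<Rightarrow> 'a \<Rightarrow> 'b :: topological_comm_monoid_add"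
  assumes "finite I" "\<And>i. i \<in> I \<Longrightarrow> (f i has_sum a i) A"
  shows "((\<lambda>x. \<Sum>i\<in>I. f i x) has_sum (\<Sum>i\<in>I. a i)) A"
  using assms by (induction I rule: finite_induct) (auto intro!: has_sum_add)

text \<open>The error functional is applied to the Fourier series term by term. The zero frequency contributes nothing because the
  weights add up to 1, and for the others the integral of the character vanishes.\<close>

lemma cubature_error_le:
  assumes d: "d \<ge> 1" and f: "f \<in> F2 d" and I: "finite I" "\<And>i. i \<in> I \<Longrightarrow> X i \<in> cube d"
    and W: "(\<Sum>i\<in>I. W i) = (1::real)" and \<epsilon>: "\<epsilon> \<ge> 0"
    and char: "\<And>k. supp d k \<noteq> {} \<Longrightarrow> norm (\<Sum>i\<in>I. of_real (W i) * chi d k (X i)) \<le> \<epsilon> * weight d k"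
  shows "\<bar>(\<integral>x. f x \<partial>cube_measure d) - (\<Sum>i\<in>I. W i * f (X i))\<bar> \<le> \<epsilon> * F2_norm d f"
proof -
  let ?K = "freqs d" and ?c = "fourier_coeff d f"
  define z where "z = (\<lambda>j\<in>{1..d}. 0 :: int)"
  have z: "z \<in> ?K" by (auto simp: z_def freqs_def)
  have "?c z = (\<integral>x. of_real (f x) * chi d (\<lambda>_. 0) x \<partial>cube_measure d)"
    by (simp add: integral_mult_chi_eq_fourier_coeff z_def)
  then have cz: "?c z = of_real (\<integral>x. f x \<partial>cube_measure d)" by (simp add: chi_def)
  \<comment> \<open>\<open>E k\<close> is the error of the rule on the character with frequency \<open>k\<close>\<close>
  define E where "E k = (\<Sum>i\<in>I. of_real (W i) * chi d k (X i)) - (if k = z then 1 else 0)" for k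
  have "((\<lambda>k. \<Sum>i\<in>I. of_real (W i) * (?c k * chi d k (X i))) has_sum
      (\<Sum>i\<in>I. of_real (W i) * of_real (f (X i)))) ?K"
    using I by (intro has_sum_sum has_sum_cmult_right fourier_inversion[OF d f])
  moreover have "((\<lambda>k. if k = z then ?c k else 0) has_sum ?c z) ?K"
    by (rule has_sum_finite_neutralI[of "{z}"]) (use z in auto)
  ultimately have "((\<lambda>k. (\<Sum>i\<in>I. of_real (W i) * (?c k * chi d k (X i))) - (if k = z then ?c k else 0)) has_sum
      ((\<Sum>i\<in>I. of_real (W i) * of_real (f (X i))) - ?c z)) ?K"
    using has_sum_add[OF _ has_sum_uminusI] by fastforce
  also have "(\<lambda>k. (\<Sum>i\<in>I. of_real (W i) * (?c k * chi d k (X i))) - (if k = z then ?c k else 0))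
     = (\<lambda>k. ?c k * E k)"
    by (auto simp: E_def fun_eq_iff sum_distrib_left right_diff_distrib mult_ac)
  also have "(\<Sum>i\<in>I. of_real (W i) * of_real (f (X i))) - ?c z
     = complex_of_real ((\<Sum>i\<in>I. W i * f (X i)) - (\<integral>x. f x \<partial>cube_measure d))"
    by (simp add: cz)
  finally have hs: "((\<lambda>k. ?c k * E k) has_sum
     complex_of_real ((\<Sum>i\<in>I. W i * f (X i)) - (\<integral>x. f x \<partial>cube_measure d))) ?K" .
  have bound: "norm (?c k * E k) \<le> \<epsilon> * (cmod (?c k) * weight d k)" if k: "k \<in> ?K" for k
  proof -
    have "norm (E k) \<le> \<epsilon> * weight d k"
    proof (cases "supp d k = {}")
      case True
      then have kz: "k = z" using k by (auto simp: supp_def z_def freqs_def PiE_def extensional_def fun_eq_iff)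
      have "(\<Sum>i\<in>I. complex_of_real (W i)) = 1" using W by (metis of_real_1 of_real_sum)
      then have "E k = 0" using True by (simp add: E_def kz chi_def supp_def)
      then show ?thesis using \<epsilon> weight_ge_1[of d k] by simp
    next
      case False
      then have "k \<noteq> z" by (auto simp: supp_def z_def)
      then show ?thesis using char[OF False] by (simp add: E_def)
    qed
    then have "cmod (?c k) * norm (E k) \<le> cmod (?c k) * (\<epsilon> * weight d k)" by (intro mult_left_mono) auto
    then show ?thesis by (simp add: norm_mult mult_ac)
  qed
  have summ: "(\<lambda>k. \<epsilon> * (cmod (?c k) * weight d k)) summable_on ?K"
    using f by (intro summable_on_cmult_right) (simp add: F2_def)
  have "\<bar>(\<integral>x. f x \<partial>cube_measure d) - (\<Sum>i\<in>I. W i * f (X i))\<bar>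
     = norm (complex_of_real ((\<Sum>i\<in>I. W i * f (X i)) - (\<integral>x. f x \<partial>cube_measure d)))"
    by (simp only: norm_of_real abs_minus_commute)
  also have "\<dots> \<le> (\<Sum>\<^sub>\<infinity>k\<in>?K. \<epsilon> * (cmod (?c k) * weight d k))"
    by (rule norm_infsum_le[OF hs has_sum_infsum[OF summ] bound])
  also have "\<dots> = \<epsilon> * F2_norm d f" by (simp add: F2_norm_def infsum_cmult_right')
  finally show ?thesis .
qed

section \<open>Combining the point sets over several primes\<close>

text \<open>Lets a cubature rule be indexed by an arbitrary finite set instead of an initial segment of the natural numbers.\<close>

lemma info_complexity_le:
  assumes I: "finite I" "I \<noteq> {}" "\<And>i. i \<in> I \<Longrightarrow> X i \<in> cube d"
    and err: "\<And>f. f \<in> F \<Longrightarrow> nrm f \<le> 1 \<Longrightarrow>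
      \<bar>(\<integral>x. f x \<partial>cube_measure d) - (\<Sum>i\<in>I. W i * f (X i))\<bar> \<le> \<epsilon>"
  shows "info_complexity \<epsilon> d F nrm \<le> enat (card I)"
proof -
  obtain e where e: "bij_betw e {..<card I} I"
    using ex_bij_betw_nat_finite[OF I(1)] by (auto simp: atLeast0LessThan)
  have "cubature (card I) (X \<circ> e) (W \<circ> e) f = (\<Sum>i\<in>I. W i * f (X i))" for f
    unfolding cubature_def using sum.reindex_bij_betw[OF e, of "\<lambda>i. W i * f (X i)"] by simp
  then have "worst_case_error d F nrm (cubature (card I) (X \<circ> e) (W \<circ> e)) \<le> ereal \<epsilon>"
    unfolding worst_case_error_def using err by (intro SUP_least) auto
  moreover have "\<forall>h<card I. (X \<circ> e) h \<in> cube d"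
    using e I(3) by (auto simp: bij_betw_def)
  moreover have "card I \<ge> 1" using I(1,2) by (simp add: Suc_le_eq card_gt_0_iff)
  ultimately show ?thesis unfolding info_complexity_def by (intro INF_lower) blast
qed

text \<open>The product of the primes in \<open>P\<close> divides \<open>n\<close>, and each of them exceeds \<open>m\<close>.\<close>

lemma card_prime_divisors_mult_ln_le:
  fixes P :: "nat set" and n :: int
  assumes "finite P" "\<And>p. p \<in> P \<Longrightarrow> prime p \<and> m < p \<and> int p dvd n" "n \<noteq> 0" "m \<ge> 1"
  shows "real (card P) * ln (real m) \<le> ln \<bar>real_of_int n\<bar>"
proof -
  have "\<Prod>P dvd nat \<bar>n\<bar>"
    using assms by (intro prod_primes_dvd) (auto simp: int_dvd_int_iff[symmetric])
  then have "\<Prod>P \<le> nat \<bar>n\<bar>" using assms(3) by (intro dvd_imp_le) auto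
  moreover have "m ^ card P \<le> \<Prod>P"
    using prod_mono[of P "\<lambda>_. m" "\<lambda>p. p"] assms(2) by (simp add: less_imp_le)
  ultimately have "real (m ^ card P) \<le> real (nat \<bar>n\<bar>)" by linarith
  then have "real m ^ card P \<le> \<bar>real_of_int n\<bar>" by simp
  then have "ln (real m ^ card P) \<le> ln \<bar>real_of_int n\<bar>"
    using assms(3,4) by (subst ln_le_cancel_iff) auto
  then show ?thesis using assms(4) by (simp add: ln_realpow)
qed

text \<open>The summand for \<open>p\<close> is the mean of the character over the point set of \<open>p\<close>. It can be as large as 1
  for the primes that divide all entries of \<open>k\<close>, which are few: their number is controlled by the entry of smallest
  modulus, hence by the logarithmic part of the weight. For the others it is controlled by the width.\<close>

lemma sum_korobov_root_fractions_le:
  assumes P: "finite P" "\<And>p. p \<in> P \<Longrightarrow> prime p \<and> m < p" and m: "m \<ge> 2" and k: "supp d k \<noteq> {}"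
  shows "(\<Sum>p\<in>P. real (card {b \<in> {..<p}. int p dvd (\<Sum>j=1..d. k j * int b ^ j)}) / real p)
    \<le> weight d k * (1 / ln (real m) + real (card P) / real m)"
proof -
  let ?R = "\<lambda>p. card {b \<in> {..<p}. int p dvd (\<Sum>j=1..d. k j * int b ^ j)}"
  let ?D = "{p \<in> P. \<forall>j\<in>{1..d}. int p dvd k j}"
  let ?\<mu> = "MIN j\<in>supp d k. ln \<bar>real_of_int (k j)\<bar>"
  have lnm: "ln (real m) > 0" using m by simp
  have fin: "finite (supp d k)" by (simp add: supp_def)
  have "?\<mu> \<in> (\<lambda>j. ln \<bar>real_of_int (k j)\<bar>) ` supp d k" using fin k by (intro Min_in) auto
  then obtain j where j: "j \<in> supp d k" "?\<mu> = ln \<bar>real_of_int (k j)\<bar>" by blast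
  have "real (card ?D) * ln (real m) \<le> ln \<bar>real_of_int (k j)\<bar>"
    using P m j(1) by (intro card_prime_divisors_mult_ln_le) (auto simp: supp_def)
  also have "\<dots> \<le> weight d k" using k j(2) by (simp add: weight_def)
  finally have D: "real (card ?D) \<le> weight d k / ln (real m)" using lnm by (simp add: pos_le_divide_eq)
  have R: "real (?R p) / real p \<le> (if p \<in> ?D then 1 else 0) + weight d k / real m" if pP: "p \<in> P" for p
  proof (cases "p \<in> ?D")
    case True
    have "?R p \<le> card {..<p}" by (intro card_mono) auto
    then have "real (?R p) / real p \<le> 1" using P(2)[OF pP] by (simp add: divide_le_eq)
    moreover have "0 \<le> weight d k / real m" using weight_ge_1[of d k] by simp
    ultimately show ?thesis using True by simp
  next
    case False
    then obtain j0 where "j0 \<in> {1..d}" "\<not> int p dvd k j0" using pP by blast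
    then have "?R p \<le> width (supp d k)" using P(2)[OF pP] by (intro card_roots_freq_le_width) auto
    then have "real (?R p) \<le> weight d k" using width_le_weight[of d k] by linarith
    then have "real (?R p) / real p \<le> weight d k / real m"
      using P(2)[OF pP] m by (intro frac_le) auto
    then show ?thesis using False by simp
  qed
  have "(\<Sum>p\<in>P. real (?R p) / real p) \<le> (\<Sum>p\<in>P. (if p \<in> ?D then 1 else 0) + weight d k / real m)"
    by (intro sum_mono R)
  also have "\<dots> = real (card ?D) + real (card P) * (weight d k / real m)"
    using P(1) by (simp add: sum.distrib sum.If_cases Int_def)
  also have "\<dots> \<le> weight d k * (1 / ln (real m) + real (card P) / real m)"
    using D by (simp add: algebra_simps)
  finally show ?thesis .
qed

text \<open>The rule is the average over \<open>p\<close> in \<open>P\<close> of the equal-weight rules on the point sets of the \<open>p\<close>. Points are indexed by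
  triples and may coincide.\<close>

lemma info_complexity_F2_le_primes:
  assumes d: "d \<ge> 1" and P: "finite P" "P \<noteq> {}" "\<And>p. p \<in> P \<Longrightarrow> prime p \<and> m < p" and m: "m \<ge> 2"
    and \<epsilon>: "1 / (real (card P) * ln (real m)) + 1 / real m \<le> \<epsilon>"
  shows "info_complexity \<epsilon> d (F2 d) (F2_norm d) \<le> enat (\<Sum>p\<in>P. p\<^sup>2)"
proof -
  define I where "I = (SIGMA p:P. {..<p} \<times> {..<p})"
  define X where "X = (\<lambda>(p, a, b). korobov_point d p a b)"
  define W where "W = (\<lambda>(p, a :: nat, b :: nat). 1 / (real (card P) * (real p)\<^sup>2))"
  have p0: "p > 0" if "p \<in> P" for p using P(3)[OF that] by simp
  have cP: "real (card P) > 0" using P(1,2) by (simp add: card_gt_0_iff)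
  have finI: "finite I" unfolding I_def using P(1) by (intro finite_SigmaI) auto
  have cardI: "card I = (\<Sum>p\<in>P. p\<^sup>2)"
    unfolding I_def using P(1) by (subst card_SigmaI) (auto simp: power2_eq_square)
  obtain p1 where "p1 \<in> P" using P(2) by blast
  then have "(p1, 0, 0) \<in> I" using p0 by (auto simp: I_def)
  then have neI: "I \<noteq> {}" by blast
  have XI: "X i \<in> cube d" for i by (simp add: X_def korobov_point_in_cube split: prod.split)
  have sumI: "(\<Sum>i\<in>I. g i) = (\<Sum>p\<in>P. \<Sum>a<p. \<Sum>b<p. g (p, a, b))"
    for g :: "nat \<times> nat \<times> nat \<Rightarrow> 'z :: comm_monoid_add"
  proof -
    have "(\<Sum>p\<in>P. \<Sum>a<p. \<Sum>b<p. g (p, a, b)) = (\<Sum>p\<in>P. \<Sum>ab\<in>{..<p} \<times> {..<p}. g (p, ab))"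
      by (simp add: sum.cartesian_product split_beta)
    also have "\<dots> = (\<Sum>(p, ab)\<in>I. g (p, ab))"
      unfolding I_def using P(1) by (intro sum.Sigma) auto
    finally show ?thesis by (simp add: split_beta)
  qed
  have "(\<Sum>i\<in>I. W i) = (\<Sum>p\<in>P. 1 / real (card P))"
    unfolding sumI using p0 by (intro sum.cong refl) (simp add: W_def power2_eq_square)
  then have W1: "(\<Sum>i\<in>I. W i) = 1" using cP by simp
  have \<epsilon>0: "\<epsilon> \<ge> 0"
    using m by (intro order_trans[OF _ \<epsilon>]) simp
  have char: "norm (\<Sum>i\<in>I. of_real (W i) * chi d k (X i)) \<le> \<epsilon> * weight d k" if k: "supp d k \<noteq> {}" for k
  proof -
    let ?R = "\<lambda>p. card {b \<in> {..<p}. int p dvd (\<Sum>j=1..d. k j * int b ^ j)}"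
    have "(\<Sum>i\<in>I. of_real (W i) * chi d k (X i))
       = (\<Sum>p\<in>P. of_real (1 / (real (card P) * (real p)\<^sup>2)) * (\<Sum>a<p. \<Sum>b<p. chi d k (korobov_point d p a b)))"
      unfolding sumI by (simp add: W_def X_def sum_distrib_left)
    also have "\<dots> = (\<Sum>p\<in>P. complex_of_real (1 / real (card P) * (real (?R p) / real p)))"
    proof (intro sum.cong refl)
      fix p assume "p \<in> P"
      then have p: "p > 0" using p0 by blast
      have "of_real (1 / (real (card P) * (real p)\<^sup>2)) * (\<Sum>a<p. \<Sum>b<p. chi d k (korobov_point d p a b))
        = complex_of_real (1 / (real (card P) * (real p)\<^sup>2) * real (p * ?R p))"
        unfolding korobov_sum_chi[OF p] by (simp only: of_real_mult of_real_of_nat_eq)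
      also have "1 / (real (card P) * (real p)\<^sup>2) * real (p * ?R p) = 1 / real (card P) * (real (?R p) / real p)"
        using p by (simp add: power2_eq_square)
      finally show "of_real (1 / (real (card P) * (real p)\<^sup>2)) * (\<Sum>a<p. \<Sum>b<p. chi d k (korobov_point d p a b))
        = complex_of_real (1 / real (card P) * (real (?R p) / real p))" .
    qed
    also have "\<dots> = complex_of_real (1 / real (card P) * (\<Sum>p\<in>P. real (?R p) / real p))"
      by (simp only: of_real_sum[symmetric] sum_distrib_left)
    finally have "norm (\<Sum>i\<in>I. of_real (W i) * chi d k (X i)) = 1 / real (card P) * (\<Sum>p\<in>P. real (?R p) / real p)"
      by (simp only: norm_of_real) (simp add: sum_nonneg)
    also have "\<dots> \<le> 1 / real (card P) * (weight d k * (1 / ln (real m) + real (card P) / real m))"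
      using sum_korobov_root_fractions_le[OF P(1,3) m k] by (intro mult_left_mono) auto
    also have "\<dots> = weight d k * (1 / (real (card P) * ln (real m)) + 1 / real m)"
      using cP by (simp add: field_simps)
    also have "\<dots> \<le> weight d k * \<epsilon>" using \<epsilon> weight_ge_1[of d k] by (intro mult_left_mono) auto
    finally show ?thesis by (simp add: mult.commute)
  qed
  have "info_complexity \<epsilon> d (F2 d) (F2_norm d) \<le> enat (card I)"
  proof (rule info_complexity_le[OF finI neI XI])
    fix f assume f: "f \<in> F2 d" "F2_norm d f \<le> 1"
    have "\<bar>(\<integral>x. f x \<partial>cube_measure d) - (\<Sum>i\<in>I. W i * f (X i))\<bar> \<le> \<epsilon> * F2_norm d f"
      by (rule cubature_error_le[OF d f(1) finI XI W1 \<epsilon>0 char])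
    also have "\<dots> \<le> \<epsilon>" using f(2) \<epsilon>0 mult_left_mono[of "F2_norm d f" 1 \<epsilon>] by simp
    finally show "\<bar>(\<integral>x. f x \<partial>cube_measure d) - (\<Sum>i\<in>I. W i * f (X i))\<bar> \<le> \<epsilon>" .
  qed
  then show ?thesis by (simp only: cardI)
qed

theorem theorem1:
  "\<exists>C\<^sub>2>0::real. \<forall>d\<ge>1. \<forall>\<epsilon>. 0 < \<epsilon> \<and> \<epsilon> < 1 \<longrightarrow>
     ereal_of_enat (info_complexity \<epsilon> d (F2 d) (F2_norm d))
       \<le> ereal (C\<^sub>2 * \<epsilon> powi (-3) / ln (inverse \<epsilon>))"
proof -
  obtain m0 where m0: "\<And>m. m \<ge> m0 \<Longrightarrow> real m \<le> 2 * real (card (window_primes m)) * ln (real m)"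
    using card_window_primes_lower unfolding eventually_sequentially by blast
  \<comment> \<open>Taking \<open>m\<close> about \<open>B / \<epsilon>\<close> with \<open>B \<ge> 3\<close> makes the error \<open>3 / m\<close> at most \<open>\<epsilon>\<close>; \<open>B \<ge> m0\<close> puts \<open>m\<close>
    in the range of the prime number bounds for all \<open>\<epsilon> < 1\<close>, so that values of \<open>\<epsilon>\<close> close to 1 are covered too.\<close>
  define B where "B = max 3 (real m0)"
  have B: "B \<ge> 3" "B \<ge> real m0" by (auto simp: B_def)
  have main: "ereal_of_enat (info_complexity \<epsilon> d (F2 d) (F2_norm d))
       \<le> ereal (768 * B ^ 3 * \<epsilon> powi (-3) / ln (inverse \<epsilon>))"
    if d: "d \<ge> 1" and \<epsilon>: "0 < \<epsilon>" "\<epsilon> < 1" for d \<epsilon>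
  proof -
    define m where "m = nat \<lceil>B / \<epsilon>\<rceil>"
    let ?P = "window_primes m"
    have Be: "B \<le> B / \<epsilon>" using B \<epsilon> by (simp add: pos_le_divide_eq mult_left_le)
    have m_ge: "B / \<epsilon> \<le> real m" unfolding m_def by (rule of_nat_ceiling)
    have "real m \<le> B / \<epsilon> + 1" unfolding m_def using Be B by linarith
    then have m_le: "real m \<le> 2 * B / \<epsilon>" using Be B by simp
    have m3: "real m \<ge> 3" using Be B m_ge by linarith
    then have m2: "m \<ge> 2" by linarith
    have "real m \<ge> real m0" using Be B m_ge by linarith
    then have card: "real m \<le> 2 * (real (card ?P) * ln (real m))" using m0[of m] by simp
    have lnm: "ln (real m) > 0" using m3 by simp
    have finP: "finite ?P" by (rule finite_subset[of _ "{..4*m}"]) auto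
    have neP: "?P \<noteq> {}"
    proof
      assume "?P = {}"
      then have "card ?P = 0" by (simp only: card.empty)
      with card have "real m \<le> 0" by (simp only: of_nat_0 mult_zero_left mult_zero_right)
      with m3 show False by simp
    qed
    have cP: "real (card ?P) > 0" using finP neP by (metis card_gt_0_iff of_nat_0_less_iff)
    have "1 / (real (card ?P) * ln (real m)) \<le> 1 / (real m / 2)"
      using card m3 cP lnm by (intro divide_left_mono mult_pos_pos) auto
    then have "1 / (real (card ?P) * ln (real m)) + 1 / real m \<le> 3 / real m" by simp
    also have "\<dots> \<le> 3 / (B / \<epsilon>)" using m_ge m3 B \<epsilon> by (intro divide_left_mono mult_pos_pos divide_pos_pos) auto
    also have "\<dots> \<le> \<epsilon>" using B \<epsilon> by (simp add: field_simps)
    finally have "info_complexity \<epsilon> d (F2 d) (F2_norm d) \<le> enat (\<Sum>p\<in>?P. p\<^sup>2)"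
      by (intro info_complexity_F2_le_primes[OF d finP neP _ m2]) auto
    then have "ereal_of_enat (info_complexity \<epsilon> d (F2 d) (F2_norm d)) \<le> ereal_of_enat (enat (\<Sum>p\<in>?P. p\<^sup>2))"
      by (simp only: ereal_of_enat_le_iff)
    also have "\<dots> = ereal (real (\<Sum>p\<in>?P. p\<^sup>2))" by (simp only: ereal_of_enat_simps)
    also have "real (\<Sum>p\<in>?P. p\<^sup>2) \<le> 768 * B ^ 3 * \<epsilon> powi (-3) / ln (inverse \<epsilon>)"
    proof -
      have "(\<Sum>p\<in>?P. p\<^sup>2) \<le> (\<Sum>p\<in>?P. (4*m)\<^sup>2)" by (intro sum_mono power_mono) auto
      then have "real (\<Sum>p\<in>?P. p\<^sup>2) \<le> real (\<Sum>p\<in>?P. (4*m)\<^sup>2)" by (simp only: of_nat_le_iff)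
      also have "\<dots> = 16 * real (card ?P) * (real m)\<^sup>2" by (simp add: power2_eq_square)
      also have "\<dots> \<le> 16 * (6 * real m / ln (real m)) * (real m)\<^sup>2"
      proof -
        have "real (card ?P) \<le> 6 * real m / ln (real m)"
          using card_window_primes_upper[of m] m2 lnm by (simp add: pos_le_divide_eq)
        then show ?thesis by (intro mult_right_mono mult_left_mono) auto
      qed
      also have "\<dots> = 96 * (real m) ^ 3 / ln (real m)" by (simp add: power2_eq_square power3_eq_cube)
      also have "\<dots> \<le> 96 * (2 * B / \<epsilon>) ^ 3 / ln (inverse \<epsilon>)"
      proof (intro frac_le mult_left_mono power_mono)
        have "inverse \<epsilon> \<le> B / \<epsilon>" using B \<epsilon> by (simp add: field_simps)
        then have "inverse \<epsilon> \<le> real m" using m_ge by linarith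
        then show "ln (inverse \<epsilon>) \<le> ln (real m)" using \<epsilon> m3 by (subst ln_le_cancel_iff) auto
        show "0 < ln (inverse \<epsilon>)" using \<epsilon> by (intro ln_gt_zero) (simp add: one_less_inverse)
      qed (use m_le B \<epsilon> in auto)
      also have "\<dots> = 768 * B ^ 3 * \<epsilon> powi (-3) / ln (inverse \<epsilon>)"
        by (simp add: power_int_minus power_divide power_mult_distrib divide_inverse power_int_def)
      finally show ?thesis .
    qed
    finally show ?thesis by simp
  qed
  show ?thesis
  proof (intro exI[of _ "768 * B ^ 3"] conjI allI impI)
    show "768 * B ^ 3 > 0" using B by simp
  qed (use main in auto)
qed

end
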